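(* Let $n\ge1$ and let $M\subset\mathbb{C}^{n+1}$ be an oriented smooth real hypersurface. Let $h$ be its second fundamental form, let $\nabla$ be the complex connection on $M$ defined in the context, and let $Z_1,\dots,Z_n$ be a local frame of holomorphic tangent vector fields. Then for all $\alpha,\beta,\gamma\in\{1,\dots,n\}$ (with summation over the repeated indices $\lambda,\bar\lambda$ from $1$ to $n$): $$\nabla_\beta h_{\alpha\bar\gamma}-\nabla_{\bar\gamma}h_{\alpha\beta}= i h_{\alpha\beta}h_{\bar\gamma 0}-i h_{\alpha\bar\gamma}h_{\beta 0}-2i h_{\beta\bar\gamma}h_{\alpha 0},$$ $$\nabla_{\bar\beta}h_{\alpha0}-\nabla_0h_{\alpha\bar\beta}= i h_{\alpha\lambda}h^{\lambda}_{\bar\beta}-i h_{\alpha\bar\lambda}h^{\bar\lambda}_{\bar\beta}+i h_{\alpha\bar\beta}h_{00},$$ $$\nabla_\beta h_{\alpha0}-\nabla_0h_{\alpha\beta}= i h_{\beta\bar\lambda}h^{\bar\lambda}_{\alpha}-i h_{\beta\lambda}h^{\lambda}_{\alpha}+i h_{\alpha\beta}h_{00}-2i h_{\alpha0}h_{\beta0},$$ $$\nabla_\alpha h_{00}-\nabla_0h_{\alpha0}= 2i h_\alpha^\lambda h_{\lambda0}-2i h_\alpha^{\bar\lambda}h_{\bar\lambda0}-i h_{\alpha\lambda}h^\lambda_0+i h_{\alpha\bar\lambda}h^{\bar\lambda}_0-i h_{\alpha0}h_{00}.$$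
   Context: Setting. $J$ is the standard complex structure of $\mathbb{C}^{n+1}$ and $D$ is the standard flat connection; both are extended complex-linearly to complex vector fields. $g$ is the $\mathbb{C}$-bilinear extension of the Euclidean metric of $\mathbb{C}^{n+1}=\mathbb{R}^{2n+2}$ to complexified tangent vectors, so that $g(\partial_{z_h},\partial_{\bar z_k})=\tfrac12\delta_{hk}$ and $g(\partial_{z_h},\partial_{z_k})=g(\partial_{\bar z_h},\partial_{\bar z_k})=0$. $M$ is oriented by a smooth real unit normal $\nu$; $T=J(\nu)$ is a unit tangent vector field, and $N=\frac{1}{\sqrt2}(\nu-iT)$ is the holomorphic unit normal. $\mathcal{H}=T^{1,0}M=T^{1,0}\mathbb{C}^{n+1}\cap\mathbb{C}TM$ is the holomorphic tangent bundle (complex rank $n$), and $\bar{\mathcal{H}}=T^{0,1}M$ is its conjugate; $\mathbb{C}TM=\mathcal{H}\oplus\bar{\mathcal{H}}\oplus\mathbb{C}T$, an orthogonal decomposition. $\Gamma(E)$ denotes smooth sections of $E$. Second fundamental form, extended $\mathbb{C}$-bilinearly to $\mathbb{C}TM$: $h(Z,W)=g(Z,D_W\nu)$ (symmetric). Connection $\nabla$ on $\mathbb{C}TM$: for $U\in\Gamma(\mathbb{C}TM)$, $Z,W\in\Gamma(\mathcal{H})$ and a smooth complex function $f$ on $M$, $$\nabla_U(Z+\bar W+fT)=D_UZ-g(D_UZ,\bar N)N+D_U\bar W-g(D_U\bar W,N)\bar N+(Uf)T.$$ Covariant derivative of $h$: $(\nabla_Z h)(U,W)=Z\,h(U,W)-h(\nabla_ZU,W)-h(U,\nabla_ZW)$.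 Index notation: $Z_{\bar\alpha}=\overline{Z_\alpha}$ and $Z_0=T$. For indices $A,B,C$ among $\alpha,\bar\alpha,0$, put $h_{AB}=h(Z_A,Z_B)$ and $\nabla_Ch_{AB}=(\nabla_{Z_C}h)(Z_A,Z_B)$. Put $g_{\alpha\bar\beta}=g(Z_\alpha,Z_{\bar\beta})$, with $g^{\alpha\bar\beta}$ determined by $\sum_\beta g^{\alpha\bar\beta}g_{\gamma\bar\beta}=\delta_{\alpha\gamma}$. Indices are raised by $h_A^{\lambda}=\sum_\mu g^{\lambda\bar\mu}h_{A\bar\mu}$ and $h_A^{\bar\lambda}=\sum_\mu g^{\mu\bar\lambda}h_{A\mu}$, for any index $A$. *)

theory Defs
  imports "HOL-Analysis.Analysis"
begin

subsection \<open>Smoothness\<close>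

text \<open>\<open>Ck_on k U f\<close> is only meant for open \<open>U\<close>.\<close>

primrec Ck_on ::
  "nat \<Rightarrow> 'a::euclidean_space set \<Rightarrow> ('a \<Rightarrow> 'b::real_normed_vector) \<Rightarrow> bool" where
  "Ck_on 0 U f \<longleftrightarrow> continuous_on U f"
| "Ck_on (Suc k) U f \<longleftrightarrow>
     f differentiable_on U \<and> (\<forall>v. Ck_on k U (\<lambda>x. frechet_derivative f (at x) v))"

text \<open>Smoothness on an arbitrary subset (below: a hypersurface or a relatively open part of it)
  is the existence of local smooth extensions.\<close>

definition smooth_on ::
  "'a::euclidean_space set \<Rightarrow> ('a \<Rightarrow> 'b::real_normed_vector) \<Rightarrow> bool" where
  "smooth_on S f \<longleftrightarrow>
     (\<forall>p\<in>S. \<exists>U F. open U \<and> p \<in> U \<and> (\<forall>k. Ck_on k U F) \<and> (\<forall>x\<in>S \<inter> U. F x = f x))"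

subsection \<open>Complexified tangent vectors of the ambient space\<close>

text \<open>The real tangent space at every point is \<open>complex^'m\<close>; the pair \<open>(X, Y)\<close> stands for the
  complexified vector \<open>X + iY\<close>, where this \<open>i\<close> is the scalar of the complexification and not the
  complex structure \<open>J\<close>. The latter is \<open>X \<mapsto> \<i> *s X\<close> on real vectors.\<close>

type_synonym 'm cvec = "(complex^'m) \<times> (complex^'m)"

definition of_real_vec :: "complex^'m::finite \<Rightarrow> 'm cvec" where
  "of_real_vec X = (X, 0)"

definition cscale :: "complex \<Rightarrow> 'm::finite cvec \<Rightarrow> 'm cvec" where
  "cscale c Z =
     (Re c *\<^sub>R fst Z - Im c *\<^sub>R snd Z, Re c *\<^sub>R snd Z + Im c *\<^sub>R fst Z)"

definition vcnj :: "'m::finite cvec \<Rightarrow> 'm cvec" where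
  "vcnj Z = (fst Z, - snd Z)"

definition Jc :: "'m::finite cvec \<Rightarrow> 'm cvec" where
  "Jc Z = (\<i> *s fst Z, \<i> *s snd Z)"

definition gc :: "'m::finite cvec \<Rightarrow> 'm cvec \<Rightarrow> complex" where
  "gc Z W = Complex (fst Z \<bullet> fst W - snd Z \<bullet> snd W) (fst Z \<bullet> snd W + snd Z \<bullet> fst W)"

subsection \<open>Oriented real hypersurfaces\<close>

definition smooth_hypersurface :: "(complex^'m::finite) set \<Rightarrow> bool" where
  "smooth_hypersurface M \<longleftrightarrow>
     (\<forall>p\<in>M. \<exists>U (\<rho> :: complex^'m \<Rightarrow> real). open U \<and> p \<in> U \<and> (\<forall>k. Ck_on k U \<rho>) \<and>
        M \<inter> U = {x \<in> U. \<rho> x = 0} \<and>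
        (\<forall>x\<in>U. \<exists>v. frechet_derivative \<rho> (at x) v \<noteq> 0))"

text \<open>Velocities of curves in \<open>M\<close> through \<open>p\<close>. For a smooth hypersurface it makes no difference
  whether the curves are smooth or merely differentiable at time \<open>0\<close>.\<close>

definition tangent_space :: "(complex^'m::finite) set \<Rightarrow> complex^'m \<Rightarrow> (complex^'m) set" where
  "tangent_space M p =
     {v. \<exists>c \<epsilon>. \<epsilon> > 0 \<and> (\<forall>t::real. \<bar>t\<bar> < \<epsilon> \<longrightarrow> c t \<in> M) \<and> c 0 = p \<and>
          (c has_vector_derivative v) (at 0)}"

definition oriented_hypersurface ::
  "(complex^'m::finite) set \<Rightarrow> (complex^'m \<Rightarrow> complex^'m) \<Rightarrow> bool" where
  "oriented_hypersurface M \<nu> \<longleftrightarrow>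
     smooth_hypersurface M \<and> smooth_on M \<nu> \<and>
     (\<forall>p\<in>M. norm (\<nu> p) = 1 \<and> (\<forall>v\<in>tangent_space M p. \<nu> p \<bullet> v = 0))"

definition Tfield :: "(complex^'m::finite \<Rightarrow> complex^'m) \<Rightarrow> complex^'m \<Rightarrow> 'm cvec" where
  "Tfield \<nu> p = Jc (of_real_vec (\<nu> p))"

definition Nfield :: "(complex^'m::finite \<Rightarrow> complex^'m) \<Rightarrow> complex^'m \<Rightarrow> 'm cvec" where
  "Nfield \<nu> p =
     cscale (complex_of_real (1 / sqrt 2)) (of_real_vec (\<nu> p) - cscale \<i> (Tfield \<nu> p))"

definition hol_tangent :: "(complex^'m::finite) set \<Rightarrow> complex^'m \<Rightarrow> 'm cvec set" where
  "hol_tangent M p =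
     {Z. fst Z \<in> tangent_space M p \<and> snd Z \<in> tangent_space M p \<and> Jc Z = cscale \<i> Z}"

text \<open>\<open>Z\<close> is a frame of the holomorphic tangent bundle over the relatively open set \<open>V\<close>.\<close>

definition hol_frame ::
  "(complex^'m::finite) set \<Rightarrow> (complex^'m) set \<Rightarrow> ('n::finite \<Rightarrow> complex^'m \<Rightarrow> 'm cvec) \<Rightarrow> bool"
  where
  "hol_frame M V Z \<longleftrightarrow>
     openin (top_of_set M) V \<and> (\<forall>\<alpha>. smooth_on V (Z \<alpha>)) \<and>
     (\<forall>p\<in>V. (\<forall>\<alpha>. Z \<alpha> p \<in> hol_tangent M p) \<and>
        (\<forall>W\<in>hol_tangent M p. \<exists>!c. W = (\<Sum>\<alpha>\<in>UNIV. cscale (c \<alpha>) (Z \<alpha> p))))"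

subsection \<open>Flat derivative, second fundamental form and connection\<close>

text \<open>Fields along \<open>M\<close> are total functions of which only the values on \<open>M\<close> matter. The derivative
  of \<open>f\<close> at \<open>p\<close> within \<open>M\<close> is a linear map on the whole ambient space whose values are
  determined only on \<open>tangent_space M p\<close>; it is used only there, that is, for
  \<open>U = (X, Y)\<close> with \<open>X\<close> and \<open>Y\<close> tangent to \<open>M\<close>. Both operators are extended
  complex-linearly in \<open>U = X + iY\<close>.\<close>

definition D_fun ::
  "(complex^'m::finite) set \<Rightarrow> complex^'m \<Rightarrow> 'm cvec \<Rightarrow> (complex^'m \<Rightarrow> complex) \<Rightarrow> complex" where
  "D_fun M p U f =
     frechet_derivative f (at p within M) (fst U)
       + \<i> * frechet_derivative f (at p within M) (snd U)"

definition D_vec ::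
  "(complex^'m::finite) set \<Rightarrow> complex^'m \<Rightarrow> 'm cvec \<Rightarrow> (complex^'m \<Rightarrow> 'm cvec) \<Rightarrow> 'm cvec" where
  "D_vec M p U X =
     frechet_derivative X (at p within M) (fst U)
       + cscale \<i> (frechet_derivative X (at p within M) (snd U))"

definition sff ::
  "(complex^'m::finite) set \<Rightarrow> (complex^'m \<Rightarrow> complex^'m) \<Rightarrow> complex^'m \<Rightarrow>
     'm cvec \<Rightarrow> 'm cvec \<Rightarrow> complex" where
  "sff M \<nu> p Z W = gc Z (D_vec M p W (\<lambda>x. of_real_vec (\<nu> x)))"

text \<open>The components \<open>Z\<close>, \<open>vcnj W\<close> and \<open>f\<close> of \<open>X = Z + vcnj W + f T\<close>, for a complexified tangent
  vector \<open>X\<close> of \<open>M\<close> at \<open>p\<close>; the decomposition is unique because the sum is direct.\<close>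

definition hol_part ::
  "(complex^'m::finite) set \<Rightarrow> (complex^'m \<Rightarrow> complex^'m) \<Rightarrow> complex^'m \<Rightarrow> 'm cvec \<Rightarrow> 'm cvec" where
  "hol_part M \<nu> p X =
     (THE Z. Z \<in> hol_tangent M p \<and>
        (\<exists>W\<in>hol_tangent M p. \<exists>f. X = Z + vcnj W + cscale f (Tfield \<nu> p)))"

definition antihol_part ::
  "(complex^'m::finite) set \<Rightarrow> (complex^'m \<Rightarrow> complex^'m) \<Rightarrow> complex^'m \<Rightarrow> 'm cvec \<Rightarrow> 'm cvec" where
  "antihol_part M \<nu> p X =
     (THE Y. Y \<in> vcnj ` hol_tangent M p \<and>
        (\<exists>Z\<in>hol_tangent M p. \<exists>f. X = Z + Y + cscale f (Tfield \<nu> p)))"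

definition T_part ::
  "(complex^'m::finite) set \<Rightarrow> (complex^'m \<Rightarrow> complex^'m) \<Rightarrow> complex^'m \<Rightarrow> 'm cvec \<Rightarrow> complex" where
  "T_part M \<nu> p X =
     (THE f. \<exists>Z\<in>hol_tangent M p. \<exists>W\<in>hol_tangent M p. X = Z + vcnj W + cscale f (Tfield \<nu> p))"

text \<open>\<open>nabla M \<nu> p U X\<close> is the covariant derivative at \<open>p\<close> of the field \<open>X\<close> in the direction of the
  vector \<open>U\<close> at \<open>p\<close>.\<close>

definition nabla ::
  "(complex^'m::finite) set \<Rightarrow> (complex^'m \<Rightarrow> complex^'m) \<Rightarrow> complex^'m \<Rightarrow>
     'm cvec \<Rightarrow> (complex^'m \<Rightarrow> 'm cvec) \<Rightarrow> 'm cvec" where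
  "nabla M \<nu> p U X =
     (let DZ = D_vec M p U (\<lambda>x. hol_part M \<nu> x (X x));
          DW = D_vec M p U (\<lambda>x. antihol_part M \<nu> x (X x));
          Uf = D_fun M p U (\<lambda>x. T_part M \<nu> x (X x));
          N = Nfield \<nu> p
      in (DZ - cscale (gc DZ (vcnj N)) N) + (DW - cscale (gc DW N) (vcnj N))
           + cscale Uf (Tfield \<nu> p))"

definition nabla_sff ::
  "(complex^'m::finite) set \<Rightarrow> (complex^'m \<Rightarrow> complex^'m) \<Rightarrow> complex^'m \<Rightarrow>
     'm cvec \<Rightarrow> (complex^'m \<Rightarrow> 'm cvec) \<Rightarrow> (complex^'m \<Rightarrow> 'm cvec) \<Rightarrow> complex" where
  "nabla_sff M \<nu> p Z U W =
     D_fun M p Z (\<lambda>x. sff M \<nu> x (U x) (W x))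
       - sff M \<nu> p (nabla M \<nu> p Z U) (W p) - sff M \<nu> p (U p) (nabla M \<nu> p Z W)"

subsection \<open>Index notation\<close>

text \<open>The indices \<open>\<alpha>\<close>, \<open>\<alpha>\<close>-bar and \<open>0\<close>.\<close>

datatype 'n frame_index = Hol 'n | Bar 'n | Zero

fun frame ::
  "(complex^'m::finite \<Rightarrow> complex^'m) \<Rightarrow> ('n \<Rightarrow> complex^'m \<Rightarrow> 'm cvec) \<Rightarrow> 'n frame_index \<Rightarrow>
     complex^'m \<Rightarrow> 'm cvec" where
  "frame \<nu> Z (Hol \<alpha>) p = Z \<alpha> p"
| "frame \<nu> Z (Bar \<alpha>) p = vcnj (Z \<alpha> p)"
| "frame \<nu> Z Zero p = Tfield \<nu> p"

definition h_comp ::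
  "(complex^'m::finite) set \<Rightarrow> (complex^'m \<Rightarrow> complex^'m) \<Rightarrow>
     ('n \<Rightarrow> complex^'m \<Rightarrow> 'm cvec) \<Rightarrow> complex^'m \<Rightarrow>
     'n frame_index \<Rightarrow> 'n frame_index \<Rightarrow> complex" where
  "h_comp M \<nu> Z p A B = sff M \<nu> p (frame \<nu> Z A p) (frame \<nu> Z B p)"

text \<open>The differentiation index comes first: \<open>nabla_h_comp M \<nu> Z p C A B\<close> is
  \<open>\<nabla>\<^sub>C h\<^sub>A\<^sub>B\<close> at \<open>p\<close>.\<close>

definition nabla_h_comp ::
  "(complex^'m::finite) set \<Rightarrow> (complex^'m \<Rightarrow> complex^'m) \<Rightarrow>
     ('n \<Rightarrow> complex^'m \<Rightarrow> 'm cvec) \<Rightarrow> complex^'m \<Rightarrow>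
     'n frame_index \<Rightarrow> 'n frame_index \<Rightarrow> 'n frame_index \<Rightarrow> complex" where
  "nabla_h_comp M \<nu> Z p C A B = nabla_sff M \<nu> p (frame \<nu> Z C p) (frame \<nu> Z A) (frame \<nu> Z B)"

definition g_comp ::
  "('n \<Rightarrow> complex^'m \<Rightarrow> 'm::finite cvec) \<Rightarrow> complex^'m \<Rightarrow> 'n \<Rightarrow> 'n \<Rightarrow> complex" where
  "g_comp Z p \<alpha> \<beta> = gc (Z \<alpha> p) (vcnj (Z \<beta> p))"

definition g_inv ::
  "('n::finite \<Rightarrow> complex^'m \<Rightarrow> 'm::finite cvec) \<Rightarrow> complex^'m \<Rightarrow> 'n \<Rightarrow> 'n \<Rightarrow> complex" where
  "g_inv Z p =
     (THE G. \<forall>\<alpha> \<gamma>. (\<Sum>\<beta>\<in>UNIV. G \<alpha> \<beta> * g_comp Z p \<gamma> \<beta>) = (if \<alpha> = \<gamma> then 1 else 0))"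

text \<open>\<open>h_up \<dots> A \<lambda>\<close> and \<open>h_up_bar \<dots> A \<lambda>\<close> are \<open>h\<close> with lower index \<open>A\<close> and upper index
  \<open>\<lambda>\<close>, respectively \<open>\<lambda>\<close>-bar.\<close>

definition h_up ::
  "(complex^'m::finite) set \<Rightarrow> (complex^'m \<Rightarrow> complex^'m) \<Rightarrow>
     ('n::finite \<Rightarrow> complex^'m \<Rightarrow> 'm cvec) \<Rightarrow> complex^'m \<Rightarrow> 'n frame_index \<Rightarrow> 'n \<Rightarrow> complex" where
  "h_up M \<nu> Z p A l = (\<Sum>\<mu>\<in>UNIV. g_inv Z p l \<mu> * h_comp M \<nu> Z p A (Bar \<mu>))"

definition h_up_bar ::
  "(complex^'m::finite) set \<Rightarrow> (complex^'m \<Rightarrow> complex^'m) \<Rightarrow>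
     ('n::finite \<Rightarrow> complex^'m \<Rightarrow> 'm cvec) \<Rightarrow> complex^'m \<Rightarrow> 'n frame_index \<Rightarrow> 'n \<Rightarrow> complex" where
  "h_up_bar M \<nu> Z p A l = (\<Sum>\<mu>\<in>UNIV. g_inv Z p \<mu> l * h_comp M \<nu> Z p A (Hol \<mu>))"

end

theory Submission
  imports Defs
begin

text \<open>A local extension of \<open>\<nu>\<close> has symmetric second differential, so differentiating
  \<open>h(X, Y) = g(X, D\<^sub>Y \<nu>)\<close> and alternating leaves only the Gauss defects
  \<open>E\<^sub>C A = D\<^sub>C A - \<nabla>\<^sub>C A\<close> of the frame fields:
  \<open>\<nabla>\<^sub>C h\<^sub>A\<^sub>B - \<nabla>\<^sub>B h\<^sub>A\<^sub>C = g(E\<^sub>C A, D\<^sub>B \<nu>) - g(E\<^sub>B A, D\<^sub>C \<nu>) + h(A, E\<^sub>C B - E\<^sub>B C)\<close>.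
  From \<open>N = (\<nu> - iT) / sqrt 2\<close> one gets \<open>E\<^sub>C Z\<^sub>\<alpha> = - h(Z\<^sub>\<alpha>, C) (\<nu> - iT)\<close>, the conjugate formula for the conjugate
  fields, and \<open>E\<^sub>C T = J(D\<^sub>C \<nu>)\<close>. Expanding \<open>D\<^sub>C \<nu>\<close> in the frame gives the four equations.\<close>

subsection \<open>Second derivatives and curves in level sets\<close>

text \<open>For tangent fields \<open>D_C B - D_B C\<close> is the Lie bracket, so
  \<open>E_C B - E_B C\<close> is minus the torsion of \<open>nabla\<close>. Brackets are never
  formed: the vector is computed explicitly in the frame, and it is tangent because the normal parts
  cancel by the symmetry of \<open>h\<close>. This symmetry is itself a theorem about the Hessian of
  a defining function. The obstacle is that a derivative within \<open>M\<close> is a chosen linear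
  map, determined only on tangent vectors, while tangent vectors are given as velocities of curves.
  Hence curves in level sets have to be constructed, to identify the tangent space with the
  hyperplane orthogonal to \<open>\<nu>\<close>, and the Leibniz rules are stated for tangent
  directions. Since \<open>D_C B\<close> may have a normal part, the derivative of
  \<open>\<nu>\<close> within \<open>M\<close> cannot be applied to it; the differential of an
  extension can.\<close>

lemma second_difference_mean_value:
  fixes f :: "'a::real_normed_vector \<Rightarrow> real"
  assumes D: "\<And>y. y \<in> ball x r \<Longrightarrow> (f has_derivative D y) (at y)"
    and D2: "\<And>y. y \<in> ball x r \<Longrightarrow> ((\<lambda>z. D z u) has_derivative D2 y) (at y)"
    and h: "h > 0" "h * (norm u + norm v) < r"
  obtains y where "dist x y \<le> h * (norm u + norm v)"
    "f (x + h *\<^sub>R u + h *\<^sub>R v) - f (x + h *\<^sub>R u) - f (x + h *\<^sub>R v) + f x = h\<^sup>2 * D2 y v"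
proof -
  have in_ball: "dist x (x + s *\<^sub>R u + t *\<^sub>R v) \<le> h * (norm u + norm v)"
    if "0 \<le> s" "s \<le> h" "0 \<le> t" "t \<le> h" for s t
  proof -
    have "dist x (x + s *\<^sub>R u + t *\<^sub>R v) \<le> norm (s *\<^sub>R u) + norm (t *\<^sub>R v)"
      by (subst dist_commute) (use norm_triangle_ineq[of "s *\<^sub>R u" "t *\<^sub>R v"] in \<open>simp add: dist_norm add.assoc\<close>)
    also have "\<dots> \<le> h * norm u + h * norm v"
      using that by (auto intro!: add_mono mult_right_mono)
    finally show ?thesis by (simp add: algebra_simps)
  qed
  \<comment> \<open>The mean value theorem is applied twice: to
    \<open>s \<mapsto> f (x + s u + h v) - f (x + s u)\<close>, whose increment is the second
    difference, and then to the derivative along \<open>u\<close> as a function of \<open>t\<close>.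
    The \<open>0 *\<^sub>R v\<close> terms keep \<open>t = 0\<close> and \<open>t = h\<close> in one
    pattern.\<close>
  have 1: "\<exists>s\<in>{0<..<h}. (f (x + h *\<^sub>R u + h *\<^sub>R v) - f (x + h *\<^sub>R u + 0 *\<^sub>R v)) - (f (x + 0 *\<^sub>R u + h *\<^sub>R v) - f (x + 0 *\<^sub>R u + 0 *\<^sub>R v))
      = (\<lambda>k. D (x + s *\<^sub>R u + h *\<^sub>R v) (k *\<^sub>R u) - D (x + s *\<^sub>R u + 0 *\<^sub>R v) (k *\<^sub>R u)) (h - 0)"
  proof (rule mvt_simple[OF h(1), where f="\<lambda>s. f (x + s *\<^sub>R u + h *\<^sub>R v) - f (x + s *\<^sub>R u + 0 *\<^sub>R v)"])
    fix s assume s: "0 \<le> s" "s \<le> h"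
    have "(f has_derivative D (x + s *\<^sub>R u + t *\<^sub>R v)) (at (x + s *\<^sub>R u + t *\<^sub>R v))" if "t = 0 \<or> t = h" for t
      using in_ball[of s t] s that h by (intro D) auto
    then have "((\<lambda>s. f (x + s *\<^sub>R u + t *\<^sub>R v)) has_derivative (\<lambda>k. D (x + s *\<^sub>R u + t *\<^sub>R v) (k *\<^sub>R u))) (at s within {0..h})"
      if "t = 0 \<or> t = h" for t
      using that by (intro has_derivative_compose[of "\<lambda>s. x + s *\<^sub>R u + t *\<^sub>R v", where g=f]) (auto intro!: derivative_eq_intros)
    then show "((\<lambda>s. f (x + s *\<^sub>R u + h *\<^sub>R v) - f (x + s *\<^sub>R u + 0 *\<^sub>R v)) has_derivative
        (\<lambda>k. D (x + s *\<^sub>R u + h *\<^sub>R v) (k *\<^sub>R u) - D (x + s *\<^sub>R u + 0 *\<^sub>R v) (k *\<^sub>R u))) (at s within {0..h})"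
      by (intro has_derivative_diff) blast+
  qed
  then obtain s where s: "0 < s" "s < h" and
    e1: "f (x + h *\<^sub>R u + h *\<^sub>R v) - f (x + h *\<^sub>R u) - f (x + h *\<^sub>R v) + f x
      = D (x + s *\<^sub>R u + h *\<^sub>R v) (h *\<^sub>R u) - D (x + s *\<^sub>R u + 0 *\<^sub>R v) (h *\<^sub>R u)"
    by auto
  have lin: "D (x + s *\<^sub>R u + t *\<^sub>R v) (h *\<^sub>R u) = h * D (x + s *\<^sub>R u + t *\<^sub>R v) u" if "t = 0 \<or> t = h" for t
  proof -
    have "(f has_derivative D (x + s *\<^sub>R u + t *\<^sub>R v)) (at (x + s *\<^sub>R u + t *\<^sub>R v))"
      using in_ball[of s t] s that h by (intro D) auto
    then show ?thesis by (simp add: linear_cmul has_derivative_linear)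
  qed
  have 2: "\<exists>t\<in>{0<..<h}. D (x + s *\<^sub>R u + h *\<^sub>R v) u - D (x + s *\<^sub>R u + 0 *\<^sub>R v) u
      = (\<lambda>k. D2 (x + s *\<^sub>R u + t *\<^sub>R v) (k *\<^sub>R v)) (h - 0)"
  proof (rule mvt_simple[OF h(1), where f="\<lambda>t. D (x + s *\<^sub>R u + t *\<^sub>R v) u"])
    fix t assume t: "0 \<le> t" "t \<le> h"
    have "((\<lambda>z. D z u) has_derivative D2 (x + s *\<^sub>R u + t *\<^sub>R v)) (at (x + s *\<^sub>R u + t *\<^sub>R v))"
      using in_ball[of s t] s t h by (intro D2) auto
    then show "((\<lambda>t. D (x + s *\<^sub>R u + t *\<^sub>R v) u) has_derivative
        (\<lambda>k. D2 (x + s *\<^sub>R u + t *\<^sub>R v) (k *\<^sub>R v))) (at t within {0..h})"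
      by (intro has_derivative_compose[of "\<lambda>t. x + s *\<^sub>R u + t *\<^sub>R v", where g="\<lambda>z. D z u"])
         (auto intro!: derivative_eq_intros)
  qed
  then obtain t where t: "0 < t" "t < h" and
    e2: "D (x + s *\<^sub>R u + h *\<^sub>R v) u - D (x + s *\<^sub>R u + 0 *\<^sub>R v) u = D2 (x + s *\<^sub>R u + t *\<^sub>R v) (h *\<^sub>R v)"
    by auto
  have "((\<lambda>z. D z u) has_derivative D2 (x + s *\<^sub>R u + t *\<^sub>R v)) (at (x + s *\<^sub>R u + t *\<^sub>R v))"
    using in_ball[of s t] s t h by (intro D2) auto
  then have lin2: "D2 (x + s *\<^sub>R u + t *\<^sub>R v) (h *\<^sub>R v) = h * D2 (x + s *\<^sub>R u + t *\<^sub>R v) v"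
    by (simp add: linear_cmul has_derivative_linear)
  show thesis
  proof (rule that)
    show "dist x (x + s *\<^sub>R u + t *\<^sub>R v) \<le> h * (norm u + norm v)"
      using in_ball s t by simp
    show "f (x + h *\<^sub>R u + h *\<^sub>R v) - f (x + h *\<^sub>R u) - f (x + h *\<^sub>R v) + f x = h\<^sup>2 * D2 (x + s *\<^sub>R u + t *\<^sub>R v) v"
    proof -
      have "D (x + s *\<^sub>R u + h *\<^sub>R v) (h *\<^sub>R u) - D (x + s *\<^sub>R u + 0 *\<^sub>R v) (h *\<^sub>R u)
          = h * (D (x + s *\<^sub>R u + h *\<^sub>R v) u - D (x + s *\<^sub>R u + 0 *\<^sub>R v) u)"
        using lin[of 0] lin[of h] by (simp only: right_diff_distrib simp_thms)
      then show ?thesis unfolding e1 e2 lin2 by (simp add: power2_eq_square)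
    qed
  qed
qed

text \<open>The second difference is unchanged when \<open>u\<close> and \<open>v\<close> are
  exchanged, so it is \<open>h\<^sup>2\<close> times either mixed derivative, each at some point
  near \<open>x\<close>. By continuity both are within half of the supposed gap of their values at
  \<open>x\<close>, yet they coincide.\<close>

lemma second_derivative_symmetric_real:
  fixes f :: "'a::real_normed_vector \<Rightarrow> real"
  assumes S: "open S" "x \<in> S"
    and D: "\<And>y. y \<in> S \<Longrightarrow> (f has_derivative D y) (at y)"
    and D2: "\<And>y u. y \<in> S \<Longrightarrow> ((\<lambda>z. D z u) has_derivative D2 u y) (at y)"
    and cont: "\<And>u v. continuous_on S (\<lambda>y. D2 u y v)"
  shows "D2 u x v = D2 v x u"
proof (rule ccontr)
  assume ne: "D2 u x v \<noteq> D2 v x u"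
  define e where "e = \<bar>D2 u x v - D2 v x u\<bar> / 2"
  have e: "e > 0" using ne by (simp add: e_def)
  obtain r where r: "r > 0" "ball x r \<subseteq> S" using S openE by blast
  have lim: "((\<lambda>y. D2 u y v) \<longlongrightarrow> D2 u x v) (nhds x)" for u v
    using cont[of u v] S tendsto_at_iff_tendsto_nhds[of "\<lambda>y. D2 u y v" x]
    by (simp add: continuous_on_eq_continuous_at isCont_def)
  have "\<forall>\<^sub>F y in nhds x. dist (D2 u y v) (D2 u x v) < e \<and> dist (D2 v y u) (D2 v x u) < e"
    using lim e by (intro eventually_conj tendstoD)
  then obtain d where d: "d > 0" and
    dd: "\<And>y. dist y x < d \<Longrightarrow> dist (D2 u y v) (D2 u x v) < e \<and> dist (D2 v y u) (D2 v x u) < e"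
    unfolding eventually_nhds_metric by blast
  define h where "h = min r d / (2 * (norm u + norm v + 1))"
  have h: "h > 0" using r d by (simp add: h_def add_nonneg_pos)
  have "h * (norm u + norm v) < h * (2 * (norm u + norm v + 1))"
    using h by (intro mult_strict_left_mono) (auto simp: add_nonneg_pos add.commute intro: order.strict_trans1)
  also have "\<dots> = min r d"
    using add_nonneg_pos[of "norm u + norm v" 1] by (simp add: h_def)
  finally have hr: "h * (norm u + norm v) < min r d" .
  obtain y where y: "dist x y \<le> h * (norm u + norm v)"
    "f (x + h *\<^sub>R u + h *\<^sub>R v) - f (x + h *\<^sub>R u) - f (x + h *\<^sub>R v) + f x = h\<^sup>2 * D2 u y v"
    using second_difference_mean_value[of x r f D u "D2 u" h v] D D2 r h hr by (metis min_less_iff_conj subsetD)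
  obtain y' where y': "dist x y' \<le> h * (norm v + norm u)"
    "f (x + h *\<^sub>R v + h *\<^sub>R u) - f (x + h *\<^sub>R v) - f (x + h *\<^sub>R u) + f x = h\<^sup>2 * D2 v y' u"
    using second_difference_mean_value[of x r f D v "D2 v" h u] D D2 r h hr
    by (metis add.commute min_less_iff_conj subsetD)
  have swap: "x + h *\<^sub>R v + h *\<^sub>R u = x + h *\<^sub>R u + h *\<^sub>R v" by simp
  have "h\<^sup>2 * D2 u y v = h\<^sup>2 * D2 v y' u" using y(2) y'(2)[unfolded swap] by linarith
  with h have "D2 u y v = D2 v y' u" by simp
  moreover have "dist (D2 u y v) (D2 u x v) < e" "dist (D2 v y' u) (D2 v x u) < e"
    using dd[of y] dd[of y'] y y' hr by (auto simp: dist_commute add.commute)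
  ultimately show False by (auto simp: e_def dist_real_def abs_if split: if_splits)
qed

lemma Ck_on_all_frechet_derivative:
  assumes "open U" "\<forall>k. Ck_on k U F"
  shows "\<And>x. x \<in> U \<Longrightarrow> (F has_derivative frechet_derivative F (at x)) (at x)"
    and "\<And>v. \<forall>k. Ck_on k U (\<lambda>x. frechet_derivative F (at x) v)"
proof -
  show "(F has_derivative frechet_derivative F (at x)) (at x)" if "x \<in> U" for x
    using assms(2)[rule_format, of "Suc 0"] that differentiable_on_eq_differentiable_at[OF assms(1), of F]
    by (simp add: frechet_derivative_works)
  show "\<forall>k. Ck_on k U (\<lambda>x. frechet_derivative F (at x) v)" for v
    using assms(2)[rule_format, of "Suc k" for k] by auto
qed

lemma second_derivative_symmetric:
  fixes F :: "'a::euclidean_space \<Rightarrow> 'b::euclidean_space"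
  assumes U: "open U" "x \<in> U" and F: "\<forall>k. Ck_on k U F"
  shows "frechet_derivative (\<lambda>y. frechet_derivative F (at y) u) (at x) v =
    frechet_derivative (\<lambda>y. frechet_derivative F (at y) v) (at x) u"
proof (rule euclidean_eqI)
  fix b :: 'b
  note D = Ck_on_all_frechet_derivative[OF U(1) F]
  note D2 = Ck_on_all_frechet_derivative[OF U(1) D(2)]
  have "continuous_on U (\<lambda>y. frechet_derivative (\<lambda>y. frechet_derivative F (at y) u) (at y) v)" for u v
    using spec[OF D2(2)[of u v], of 0] by simp
  then show "frechet_derivative (\<lambda>y. frechet_derivative F (at y) u) (at x) v \<bullet> b =
    frechet_derivative (\<lambda>y. frechet_derivative F (at y) v) (at x) u \<bullet> b"
    using U D(1) D2(1)
    by (intro second_derivative_symmetric_real[of U x "\<lambda>x. F x \<bullet> b" "\<lambda>x v. frechet_derivative F (at x) v \<bullet> b"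
         "\<lambda>v y u. frechet_derivative (\<lambda>y. frechet_derivative F (at y) v) (at y) u \<bullet> b"])
       (auto intro!: has_derivative_inner_left continuous_intros)
qed

section \<open>Curves in regular level sets and differentials of moving vectors\<close>

text \<open>The linear part of \<open>\<rho>\<close> at \<open>p + t v + s w\<close> is
  \<open>s\<close>, and the remainder is at most \<open>e |t|\<close>. So \<open>\<rho>\<close>
  changes sign between \<open>s = - e |t|\<close> and \<open>s = e |t|\<close>, and the intermediate
  value theorem gives a zero.\<close>

lemma level_set_near_kernel:
  fixes \<rho> :: "'a::real_normed_vector \<Rightarrow> real"
  assumes U: "open U" "p \<in> U" and cont: "continuous_on U \<rho>" and der: "(\<rho> has_derivative \<rho>') (at p)"
    and 0: "\<rho> p = 0" "\<rho>' v = 0" "\<rho>' w = 1" and e: "e > 0"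
  shows "\<exists>d>0. \<forall>t. \<bar>t\<bar> < d \<longrightarrow>
    (\<exists>s. \<bar>s\<bar> \<le> e * \<bar>t\<bar> \<and> p + t *\<^sub>R v + s *\<^sub>R w \<in> U \<and> \<rho> (p + t *\<^sub>R v + s *\<^sub>R w) = 0)"
proof -
  \<comment> \<open>For \<open>|s| \<le> e |t|\<close> the point stays within \<open>|t| K\<close>
    of \<open>p\<close>, so accuracy \<open>e / K\<close> in the differentiability of
    \<open>\<rho>\<close> yields the error \<open>e |t|\<close>. The summand 1 keeps
    \<open>K\<close> positive.\<close>
  define K where "K = norm v + e * norm w + 1"
  have K: "K > 0" using e by (simp add: K_def add_nonneg_pos)
  obtain r where r: "r > 0" "ball p r \<subseteq> U" using U openE by blast
  obtain d where d: "d > 0" and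
    dd: "\<And>y. norm (y - p) < d \<Longrightarrow> norm (\<rho> y - \<rho> p - \<rho>' (y - p)) \<le> (e / K) * norm (y - p)"
    using der e K unfolding has_derivative_at_alt by (metis divide_pos_pos)
  interpret bounded_linear \<rho>' using der by (rule has_derivative_bounded_linear)
  show ?thesis
  proof (rule exI[of _ "min r d / K"], intro conjI allI impI)
    show "min r d / K > 0" using r d K by simp
    fix t assume t: "\<bar>t\<bar> < min r d / K"
    define y where "y = (\<lambda>s. p + t *\<^sub>R v + s *\<^sub>R w)"
    have near: "norm (y s - p) \<le> \<bar>t\<bar> * K" if "\<bar>s\<bar> \<le> e * \<bar>t\<bar>" for s
    proof -
      have "norm (y s - p) \<le> \<bar>t\<bar> * norm v + \<bar>s\<bar> * norm w"
        unfolding y_def using norm_triangle_ineq[of "t *\<^sub>R v" "s *\<^sub>R w"] by (simp add: algebra_simps)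
      also have "\<dots> \<le> \<bar>t\<bar> * norm v + (e * \<bar>t\<bar>) * norm w"
        using that by (intro add_left_mono mult_right_mono) auto
      also have "\<dots> \<le> \<bar>t\<bar> * K" by (simp add: K_def algebra_simps)
      finally show ?thesis .
    qed
    have tK: "\<bar>t\<bar> * K < min r d" using t K by (simp add: field_simps)
    have inU: "y s \<in> U" if "\<bar>s\<bar> \<le> e * \<bar>t\<bar>" for s
      using near[OF that] tK r by (auto simp: dist_norm norm_minus_commute)
    have est: "\<bar>\<rho> (y s) - s\<bar> \<le> e * \<bar>t\<bar>" if "\<bar>s\<bar> \<le> e * \<bar>t\<bar>" for s
    proof -
      have "\<bar>\<rho> (y s) - \<rho> p - \<rho>' (y s - p)\<bar> \<le> (e / K) * norm (y s - p)"
        using dd[of "y s"] near[OF that] tK by simp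
      also have "\<dots> \<le> (e / K) * (\<bar>t\<bar> * K)"
        using near[OF that] e K by (intro mult_left_mono) auto
      also have "\<dots> = e * \<bar>t\<bar>" using K by simp
      finally show ?thesis using 0 by (simp add: y_def add scale)
    qed
    have a0: "0 \<le> e * \<bar>t\<bar>" using e by simp
    have "\<exists>s\<ge>-(e * \<bar>t\<bar>). s \<le> e * \<bar>t\<bar> \<and> \<rho> (y s) = 0"
    proof (rule IVT')
      show "\<rho> (y (- (e * \<bar>t\<bar>))) \<le> 0" using est[of "- (e * \<bar>t\<bar>)"] a0 by auto
      show "0 \<le> \<rho> (y (e * \<bar>t\<bar>))" using est[of "e * \<bar>t\<bar>"] a0 by auto
      show "- (e * \<bar>t\<bar>) \<le> e * \<bar>t\<bar>" using a0 by linarith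
      show "continuous_on {- (e * \<bar>t\<bar>)..e * \<bar>t\<bar>} (\<lambda>s. \<rho> (y s))"
      proof (rule continuous_on_compose2[OF cont])
        show "continuous_on {- (e * \<bar>t\<bar>)..e * \<bar>t\<bar>} y"
          unfolding y_def by (intro continuous_intros)
      qed (use inU in auto)
    qed
    then obtain s where "\<bar>s\<bar> \<le> e * \<bar>t\<bar>" "\<rho> (y s) = 0" by (metis abs_le_iff minus_le_iff)
    then show "\<exists>s. \<bar>s\<bar> \<le> e * \<bar>t\<bar> \<and> p + t *\<^sub>R v + s *\<^sub>R w \<in> U \<and> \<rho> (p + t *\<^sub>R v + s *\<^sub>R w) = 0"
      using inU[of s] unfolding y_def by blast
  qed
qed

text \<open>For \<open>v\<close> in the kernel the curve is \<open>t \<mapsto> p + tv + s(t)w\<close> with \<open>s(t)\<close> a zero of nearly minimal modulus: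
  no choice of a minimal zero, hence no closedness of \<open>U\<close>, is needed, and \<open>s(t) = o(t)\<close>.\<close>

lemma level_set_curve:
  fixes \<rho> :: "'a::real_normed_vector \<Rightarrow> real"
  assumes U: "open U" "p \<in> U" and cont: "continuous_on U \<rho>" and der: "(\<rho> has_derivative \<rho>') (at p)"
    and 0: "\<rho> p = 0" "\<rho>' v = 0" "\<rho>' w \<noteq> 0"
  obtains c \<epsilon> where "\<epsilon> > 0" "\<And>t. \<bar>t\<bar> < \<epsilon> \<Longrightarrow> c t \<in> U \<and> \<rho> (c t) = 0" "c 0 = p"
    "(c has_vector_derivative v) (at 0)"
proof -
  interpret bounded_linear \<rho>' using der by (rule has_derivative_bounded_linear)
  define w' where "w' = (1 / \<rho>' w) *\<^sub>R w"
  have w': "\<rho>' w' = 1" using 0 by (simp add: w'_def scale)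
  define Q where "Q = (\<lambda>t. {s. p + t *\<^sub>R v + s *\<^sub>R w' \<in> U \<and> \<rho> (p + t *\<^sub>R v + s *\<^sub>R w') = 0})"
  have small: "\<exists>d>0. \<forall>t. \<bar>t\<bar> < d \<longrightarrow> (\<exists>s\<in>Q t. \<bar>s\<bar> \<le> e * \<bar>t\<bar>)" if "e > 0" for e
    using level_set_near_kernel[OF U cont der 0(1,2) w' that] unfolding Q_def by blast
  \<comment> \<open>The slack \<open>t\<^sup>2\<close> is positive for \<open>t \<noteq> 0\<close>,
    so some element of \<open>Q t\<close> comes that close to the infimum of moduli, and it is
    \<open>o(t)\<close>. The value 0 is the default where \<open>Q t\<close> is empty.\<close>
  have "\<exists>s. (t = 0 \<longrightarrow> s = 0) \<and> (Q t \<noteq> {} \<longrightarrow> s \<in> Q t \<and> (\<forall>s'\<in>Q t. \<bar>s\<bar> \<le> \<bar>s'\<bar> + t\<^sup>2))" for t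
  proof (cases "t = 0 \<or> Q t = {}")
    case True
    have "0 \<in> Q 0" using U 0 by (simp add: Q_def)
    with True show ?thesis by (intro exI[of _ 0]) auto
  next
    case False
    have bb: "bdd_below (abs ` Q t)" by (rule bdd_belowI[of _ 0]) auto
    have "Inf (abs ` Q t) < Inf (abs ` Q t) + t\<^sup>2" using False by simp
    then obtain s where s: "s \<in> Q t" "\<bar>s\<bar> < Inf (abs ` Q t) + t\<^sup>2"
      using False cInf_lessD[of "abs ` Q t" "Inf (abs ` Q t) + t\<^sup>2"] by auto
    have "\<bar>s\<bar> \<le> \<bar>s'\<bar> + t\<^sup>2" if "s' \<in> Q t" for s'
      using cInf_lower[OF imageI[OF that] bb] s by linarith
    with s False show ?thesis by blast
  qed
  then obtain s where s0: "s 0 = 0"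
    and sQ: "\<And>t. Q t \<noteq> {} \<Longrightarrow> s t \<in> Q t"
    and smin: "\<And>t s'. s' \<in> Q t \<Longrightarrow> \<bar>s t\<bar> \<le> \<bar>s'\<bar> + t\<^sup>2"
  proof -
    assume *: "\<And>s. s 0 = 0 \<Longrightarrow> (\<And>t. Q t \<noteq> {} \<Longrightarrow> s t \<in> Q t) \<Longrightarrow>
      (\<And>t s'. s' \<in> Q t \<Longrightarrow> \<bar>s t\<bar> \<le> \<bar>s'\<bar> + t\<^sup>2) \<Longrightarrow> thesis"
    assume "\<And>t. \<exists>s. (t = 0 \<longrightarrow> s = 0) \<and> (Q t \<noteq> {} \<longrightarrow> s \<in> Q t \<and> (\<forall>s'\<in>Q t. \<bar>s\<bar> \<le> \<bar>s'\<bar> + t\<^sup>2))"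
    then obtain s where "\<And>t. (t = 0 \<longrightarrow> s t = 0) \<and> (Q t \<noteq> {} \<longrightarrow> s t \<in> Q t \<and> (\<forall>s'\<in>Q t. \<bar>s t\<bar> \<le> \<bar>s'\<bar> + t\<^sup>2))"
      by moura
    then show thesis by (intro *[of s]) auto
  qed
  have "(s has_derivative (\<lambda>_. 0)) (at 0)"
    unfolding has_derivative_at_alt
  proof (intro conjI allI impI)
    fix e :: real assume e: "e > 0"
    obtain d where d: "d > 0" "\<And>t. \<bar>t\<bar> < d \<Longrightarrow> \<exists>s\<in>Q t. \<bar>s\<bar> \<le> e / 2 * \<bar>t\<bar>"
      using small[of "e / 2"] e by auto
    show "\<exists>d>0. \<forall>y. norm (y - 0) < d \<longrightarrow> norm (s y - s 0 - 0) \<le> e * norm (y - 0)"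
    proof (intro exI conjI allI impI)
      show "min d (e / 2) > 0" using d e by simp
      fix t :: real assume t: "norm (t - 0) < min d (e / 2)"
      then obtain s' where s': "s' \<in> Q t" "\<bar>s'\<bar> \<le> e / 2 * \<bar>t\<bar>" using d by auto
      have "t\<^sup>2 = \<bar>t\<bar> * \<bar>t\<bar>" by (simp add: power2_eq_square)
      also have "\<dots> \<le> e / 2 * \<bar>t\<bar>" using t by (intro mult_right_mono) auto
      finally have "\<bar>s t\<bar> \<le> e / 2 * \<bar>t\<bar> + e / 2 * \<bar>t\<bar>" using smin[OF s'(1)] s'(2) by linarith
      then show "norm (s t - s 0 - 0) \<le> e * norm (t - 0)" using s0 by simp
    qed
  qed simp
  then have "((\<lambda>t. p + t *\<^sub>R v + s t *\<^sub>R w') has_derivative (\<lambda>t. t *\<^sub>R v)) (at 0)"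
    by (auto intro!: derivative_eq_intros)
  then have vd: "((\<lambda>t. p + t *\<^sub>R v + s t *\<^sub>R w') has_vector_derivative v) (at 0)"
    by (simp add: has_vector_derivative_def)
  obtain d where d: "d > 0" "\<And>t. \<bar>t\<bar> < d \<Longrightarrow> \<exists>s\<in>Q t. \<bar>s\<bar> \<le> 1 * \<bar>t\<bar>"
    using small[of 1] by auto
  show thesis
  proof (rule that[of d "\<lambda>t. p + t *\<^sub>R v + s t *\<^sub>R w'"])
    fix t :: real assume "\<bar>t\<bar> < d"
    then have "s t \<in> Q t" using d sQ by blast
    then show "p + t *\<^sub>R v + s t *\<^sub>R w' \<in> U \<and> \<rho> (p + t *\<^sub>R v + s t *\<^sub>R w') = 0" by (simp add: Q_def)
  qed (use d s0 vd in auto)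
qed

text \<open>Smoothness controls \<open>x \<mapsto> dF_x(v)\<close> only for fixed \<open>v\<close>.
  A moving argument is therefore expanded in the basis, each coordinate is treated by the product
  rule, and the sums are reassembled by linearity.\<close>

lemma has_derivative_frechet_derivative_apply:
  fixes F :: "'a::euclidean_space \<Rightarrow> 'b::euclidean_space"
  assumes U: "open U" "p \<in> U" and F: "\<forall>k. Ck_on k U F"
    and w: "(w has_derivative w') (at p within S)"
  shows "((\<lambda>x. frechet_derivative F (at x) (w x)) has_derivative
    (\<lambda>h. frechet_derivative (\<lambda>x. frechet_derivative F (at x) (w p)) (at p) h
      + frechet_derivative F (at p) (w' h))) (at p within S)"
proof -
  note D = Ck_on_all_frechet_derivative[OF U(1) F]
  note D2 = Ck_on_all_frechet_derivative[OF U(1) D(2)]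
  have expand: "L v = (\<Sum>b\<in>Basis. (v \<bullet> b) *\<^sub>R L b)" if "linear L" for L :: "'a \<Rightarrow> 'b" and v
    using that by (subst (1) euclidean_representation[symmetric]) (simp only: linear_sum linear_cmul)
  have linD: "linear (frechet_derivative F (at x))" if "x \<in> U" for x
    using D(1)[OF that] by (rule has_derivative_linear)
  \<comment> \<open>Linearity in the inner direction \<open>b\<close> is hidden in the iterated
    derivative; symmetry moves \<open>b\<close> to the outer slot, the argument of a
    derivative.\<close>
  have linD2: "linear (\<lambda>b. frechet_derivative (\<lambda>x. frechet_derivative F (at x) b) (at p) h)" for h
  proof -
    have "(\<lambda>b. frechet_derivative (\<lambda>x. frechet_derivative F (at x) b) (at p) h) =
        frechet_derivative (\<lambda>x. frechet_derivative F (at x) h) (at p)"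
      by (rule ext) (rule second_derivative_symmetric[OF U F])
    then show ?thesis using has_derivative_linear[OF D2(1)[OF U(2)]] by simp
  qed
  have "((\<lambda>x. \<Sum>b\<in>Basis. (w x \<bullet> b) *\<^sub>R frechet_derivative F (at x) b) has_derivative
      (\<lambda>h. \<Sum>b\<in>Basis. (w p \<bullet> b) *\<^sub>R frechet_derivative (\<lambda>x. frechet_derivative F (at x) b) (at p) h
        + (w' h \<bullet> b) *\<^sub>R frechet_derivative F (at p) b)) (at p within S)"
    using D2(1)[OF U(2)] w
    by (intro has_derivative_sum has_derivative_scaleR has_derivative_inner_left)
      (auto intro: has_derivative_at_withinI)
  moreover have "(\<Sum>b\<in>Basis. (w p \<bullet> b) *\<^sub>R frechet_derivative (\<lambda>x. frechet_derivative F (at x) b) (at p) h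
        + (w' h \<bullet> b) *\<^sub>R frechet_derivative F (at p) b) =
      frechet_derivative (\<lambda>x. frechet_derivative F (at x) (w p)) (at p) h + frechet_derivative F (at p) (w' h)" for h
    by (simp add: sum.distrib expand[OF linD[OF U(2)], of "w' h"] expand[OF linD2, of "w p" h])
  ultimately have "((\<lambda>x. \<Sum>b\<in>Basis. (w x \<bullet> b) *\<^sub>R frechet_derivative F (at x) b) has_derivative
      (\<lambda>h. frechet_derivative (\<lambda>x. frechet_derivative F (at x) (w p)) (at p) h
        + frechet_derivative F (at p) (w' h))) (at p within S)"
    by simp
  then show ?thesis
    by (rule has_derivative_transform_within_open[OF _ U]) (simp add: expand[OF linD, symmetric])
qed

subsection \<open>Complexified vectors\<close>

lemma fst_cscale [simp]: "fst (cscale c Z) = Re c *\<^sub>R fst Z - Im c *\<^sub>R snd Z"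
  and snd_cscale [simp]: "snd (cscale c Z) = Re c *\<^sub>R snd Z + Im c *\<^sub>R fst Z"
  by (simp_all add: cscale_def)

lemma fst_vcnj [simp]: "fst (vcnj Z) = fst Z"
  and snd_vcnj [simp]: "snd (vcnj Z) = - snd Z"
  by (simp_all add: vcnj_def)

lemma fst_Jc [simp]: "fst (Jc Z) = \<i> *s fst Z"
  and snd_Jc [simp]: "snd (Jc Z) = \<i> *s snd Z"
  by (simp_all add: Jc_def)

lemma fst_of_real_vec [simp]: "fst (of_real_vec X) = X"
  and snd_of_real_vec [simp]: "snd (of_real_vec X) = 0"
  by (simp_all add: of_real_vec_def)

lemma cscale_cscale [simp]: "cscale a (cscale b Z) = cscale (a * b) Z"
  by (simp add: prod_eq_iff algebra_simps)

lemma cscale_one [simp]: "cscale 1 Z = Z"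
  and cscale_zero_left [simp]: "cscale 0 Z = 0"
  and cscale_zero_right [simp]: "cscale c 0 = 0"
  by (simp_all add: prod_eq_iff)

lemma cscale_add_right: "cscale c (Z + W) = cscale c Z + cscale c W"
  and cscale_diff_right: "cscale c (Z - W) = cscale c Z - cscale c W"
  and cscale_minus_right: "cscale c (- Z) = - cscale c Z"
  and cscale_add_left: "cscale (a + b) Z = cscale a Z + cscale b Z"
  and cscale_diff_left: "cscale (a - b) Z = cscale a Z - cscale b Z"
  and cscale_minus_left: "cscale (- a) Z = - cscale a Z"
  by (simp_all add: prod_eq_iff algebra_simps)

lemmas cscale_simps = cscale_add_right cscale_diff_right cscale_minus_right
  cscale_add_left cscale_diff_left cscale_minus_left

lemma cscale_sum_right: "cscale c (sum f A) = (\<Sum>i\<in>A. cscale c (f i))"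
  by (induction A rule: infinite_finite_induct) (simp_all add: cscale_add_right)

lemma cscale_of_real: "cscale (complex_of_real r) Z = r *\<^sub>R Z"
  by (simp add: prod_eq_iff)

lemma vcnj_vcnj [simp]: "vcnj (vcnj Z) = Z"
  and vcnj_zero [simp]: "vcnj 0 = 0"
  and vcnj_add: "vcnj (Z + W) = vcnj Z + vcnj W"
  and vcnj_diff: "vcnj (Z - W) = vcnj Z - vcnj W"
  and vcnj_minus: "vcnj (- Z) = - vcnj Z"
  and vcnj_cscale: "vcnj (cscale c Z) = cscale (cnj c) (vcnj Z)"
  and vcnj_of_real_vec [simp]: "vcnj (of_real_vec X) = of_real_vec X"
  by (simp_all add: prod_eq_iff)

lemma vcnj_sum: "vcnj (sum f A) = (\<Sum>i\<in>A. vcnj (f i))"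
  by (induction A rule: infinite_finite_induct) (simp_all add: vcnj_add)

lemma Jc_add: "Jc (Z + W) = Jc Z + Jc W"
  and Jc_diff: "Jc (Z - W) = Jc Z - Jc W"
  and Jc_zero [simp]: "Jc 0 = 0"
  and Jc_cscale: "Jc (cscale c Z) = cscale c (Jc Z)"
  and Jc_Jc [simp]: "Jc (Jc Z) = - Z"
  and Jc_vcnj: "Jc (vcnj Z) = vcnj (Jc Z)"
  by (simp_all add: prod_eq_iff vec_eq_iff complex_eq_iff)

lemma Jc_sum: "Jc (sum f A) = (\<Sum>i\<in>A. Jc (f i))"
  by (induction A rule: infinite_finite_induct) (simp_all add: Jc_add)

lemma gc_commute: "gc Z W = gc W Z"
  and gc_add_left: "gc (Z + Z') W = gc Z W + gc Z' W"
  and gc_diff_left: "gc (Z - Z') W = gc Z W - gc Z' W"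
  and gc_minus_left: "gc (- Z) W = - gc Z W"
  and gc_zero_left [simp]: "gc 0 W = 0"
  and gc_cscale_left: "gc (cscale c Z) W = c * gc Z W"
  and gc_vcnj: "gc (vcnj Z) (vcnj W) = cnj (gc Z W)"
  by (simp_all add: gc_def complex_eq_iff inner_add_left inner_diff_left inner_commute algebra_simps)

lemma gc_add_right: "gc W (Z + Z') = gc W Z + gc W Z'"
  and gc_diff_right: "gc W (Z - Z') = gc W Z - gc W Z'"
  and gc_minus_right: "gc W (- Z) = - gc W Z"
  and gc_zero_right [simp]: "gc W 0 = 0"
  and gc_cscale_right: "gc W (cscale c Z) = c * gc W Z"
  by (simp_all add: gc_commute[of W] gc_add_left gc_diff_left gc_minus_left gc_cscale_left)

lemmas gc_simps = gc_add_left gc_diff_left gc_minus_left gc_cscale_left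
  gc_add_right gc_diff_right gc_minus_right gc_cscale_right

lemma gc_sum_left: "gc (sum f A) W = (\<Sum>i\<in>A. gc (f i) W)"
  by (induction A rule: infinite_finite_induct) (simp_all add: gc_add_left)

lemma gc_sum_right: "gc W (sum f A) = (\<Sum>i\<in>A. gc W (f i))"
  by (induction A rule: infinite_finite_induct) (simp_all add: gc_add_right)

lemma inner_i_left: "(\<i> *s X) \<bullet> Y = - (X \<bullet> (\<i> *s Y))" for X Y :: "complex^'m"
  by (simp add: inner_vec_def inner_complex_def sum_negf[symmetric] algebra_simps)

lemma gc_Jc_left: "gc (Jc Z) W = - gc Z (Jc W)"
  by (simp add: gc_def complex_eq_iff inner_i_left)

text \<open>Pairing with the conjugate is positive definite, whereas the bilinear \<open>gc\<close>
  vanishes identically on holomorphic tangent spaces. This positivity is what makes the metric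
  matrix invertible.\<close>

lemma gc_vcnj_self_eq_zero_iff: "gc Z (vcnj Z) = 0 \<longleftrightarrow> Z = 0"
proof
  assume "gc Z (vcnj Z) = 0"
  then have "fst Z \<bullet> fst Z + snd Z \<bullet> snd Z = 0" by (simp add: gc_def complex_eq_iff)
  then show "Z = 0" by (simp add: add_nonneg_eq_0_iff prod_eq_iff)
qed simp

lemma bounded_bilinear_gc: "bounded_bilinear gc"
  unfolding bilinear_conv_bounded_bilinear[symmetric]
  by (simp add: bilinear_def linear_iff gc_add_left gc_add_right gc_cscale_left gc_cscale_right
      scaleR_conv_of_real flip: cscale_of_real)

lemma bounded_linear_Jc: "bounded_linear Jc"
  unfolding linear_conv_bounded_linear[symmetric]
  by (rule linearI) (simp_all add: Jc_add cscale_of_real[symmetric] Jc_cscale)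

lemma bounded_linear_vcnj: "bounded_linear vcnj"
  unfolding linear_conv_bounded_linear[symmetric]
  by (rule linearI) (simp_all add: vcnj_add cscale_of_real[symmetric] vcnj_cscale)

lemma bounded_linear_of_real_vec: "bounded_linear of_real_vec"
  unfolding linear_conv_bounded_linear[symmetric]
  by (rule linearI) (simp_all add: prod_eq_iff)

subsection \<open>Derivatives within a hypersurface\<close>

text \<open>There may be many derivatives within \<open>M\<close>, and
  \<open>frechet_derivative\<close> chooses one. The chain rule along a curve in \<open>M\<close>
  with velocity \<open>v\<close> shows that all of them agree at \<open>v\<close>.\<close>

lemma frechet_derivative_within_tangent:
  assumes f: "(f has_derivative f') (at p within M)" and v: "v \<in> tangent_space M p"
  shows "frechet_derivative f (at p within M) v = f' v"
proof -
  from v obtain c \<epsilon> where c: "\<epsilon> > 0" "\<And>t::real. \<bar>t\<bar> < \<epsilon> \<Longrightarrow> c t \<in> M" "c 0 = p"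
      "(c has_vector_derivative v) (at 0)"
    unfolding tangent_space_def by blast
  have *: "((f \<circ> c) has_vector_derivative g v) (at 0)" if g: "(f has_derivative g) (at p within M)" for g
  proof -
    have "((f \<circ> c) has_derivative (g \<circ> (\<lambda>t. t *\<^sub>R v))) (at 0 within ball 0 \<epsilon>)"
    proof (rule diff_chain_within)
      show "(c has_derivative (\<lambda>t. t *\<^sub>R v)) (at 0 within ball 0 \<epsilon>)"
        using c(4) unfolding has_vector_derivative_def by (rule has_derivative_at_withinI)
      show "(f has_derivative g) (at (c 0) within c ` ball 0 \<epsilon>)"
        unfolding c(3) using g by (rule has_derivative_subset) (use c(2) in auto)
    qed
    moreover have "g (t *\<^sub>R v) = t *\<^sub>R g v" for t
      using g by (simp add: has_derivative_linear linear_cmul)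
    ultimately show ?thesis
      using c(1) by (simp add: has_vector_derivative_def at_within_open[of 0 "ball 0 \<epsilon>"] o_def)
  qed
  have "(f has_derivative frechet_derivative f (at p within M)) (at p within M)"
    using f differentiableI frechet_derivative_works by blast
  from *[OF this] *[OF f] show ?thesis by (rule vector_derivative_unique_at)
qed

lemma has_derivative_transform_openin:
  assumes f: "(f has_derivative f') (at p within M)" and V: "openin (top_of_set M) V" "p \<in> V"
    and eq: "\<And>x. x \<in> V \<Longrightarrow> f x = g x"
  shows "(g has_derivative f') (at p within M)"
proof -
  obtain e where e: "e > 0" "\<And>x. x \<in> M \<Longrightarrow> dist x p < e \<Longrightarrow> x \<in> V"
    using V by (metis openin_euclidean_subtopology_iff)
  have "p \<in> M" using V openin_imp_subset by blast
  show ?thesis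
    by (rule has_derivative_transform_within[OF f e(1) \<open>p \<in> M\<close>]) (use e(2) eq in blast)
qed

text \<open>Functions agreeing on a neighbourhood of \<open>p\<close> in \<open>M\<close> have
  exactly the same derivatives within \<open>M\<close>, so the choice picks the same linear map for
  both, even off the tangent space.\<close>

lemma frechet_derivative_cong_openin:
  assumes V: "openin (top_of_set M) V" "p \<in> V" and eq: "\<And>x. x \<in> V \<Longrightarrow> f x = g x"
  shows "frechet_derivative f (at p within M) = frechet_derivative g (at p within M)"
proof -
  have "(f has_derivative f') (at p within M) \<longleftrightarrow> (g has_derivative f') (at p within M)" for f'
    using has_derivative_transform_openin[OF _ V, of f f' g] has_derivative_transform_openin[OF _ V, of g f' f]
      eq by auto
  then show ?thesis unfolding frechet_derivative_def by simp
qed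

lemma smooth_on_imp_differentiable:
  assumes f: "smooth_on V f" and V: "openin (top_of_set M) V" "p \<in> V"
  shows "f differentiable (at p within M)"
proof -
  from bspec[OF f[unfolded smooth_on_def] V(2)]
  obtain U F where U: "open U" "p \<in> U" "\<forall>k. Ck_on k U F" and eq: "\<forall>x\<in>V \<inter> U. F x = f x"
    by (elim exE conjE)
  have "(F has_derivative frechet_derivative F (at p)) (at p within M)"
    using Ck_on_all_frechet_derivative(1)[OF U(1,3,2)] by (rule has_derivative_at_withinI)
  then have "(f has_derivative frechet_derivative F (at p)) (at p within M)"
    by (rule has_derivative_transform_openin[of _ _ _ _ "V \<inter> U"]) (use U V eq in \<open>auto intro: openin_Int_open\<close>)
  then show ?thesis by (rule differentiableI)
qed

definition ctangent_space :: "(complex^'m::finite) set \<Rightarrow> complex^'m \<Rightarrow> 'm cvec set" where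
  "ctangent_space M p = tangent_space M p \<times> tangent_space M p"

lemma has_derivative_frechet_within:
  assumes "X differentiable (at p within M)"
  shows "(X has_derivative frechet_derivative X (at p within M)) (at p within M)"
  using assms frechet_derivative_works by blast

lemma D_vec_eq:
  assumes "(X has_derivative X') (at p within M)" "U \<in> ctangent_space M p"
  shows "D_vec M p U X = X' (fst U) + cscale \<i> (X' (snd U))"
  using assms by (auto simp: D_vec_def ctangent_space_def mem_Times_iff frechet_derivative_within_tangent)

lemma D_fun_eq:
  assumes "(f has_derivative f') (at p within M)" "U \<in> ctangent_space M p"
  shows "D_fun M p U f = f' (fst U) + \<i> * f' (snd U)"
  using assms by (auto simp: D_fun_def ctangent_space_def mem_Times_iff frechet_derivative_within_tangent)

lemma D_vec_cong_openin:
  assumes "openin (top_of_set M) V" "p \<in> V" "\<And>x. x \<in> V \<Longrightarrow> X x = Y x"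
  shows "D_vec M p U X = D_vec M p U Y"
  unfolding D_vec_def using frechet_derivative_cong_openin[OF assms] by simp

lemma D_fun_cong_openin:
  assumes "openin (top_of_set M) V" "p \<in> V" "\<And>x. x \<in> V \<Longrightarrow> f x = g x"
  shows "D_fun M p U f = D_fun M p U g"
  unfolding D_fun_def using frechet_derivative_cong_openin[OF assms] by simp

lemma D_vec_const [simp]: "U \<in> ctangent_space M p \<Longrightarrow> D_vec M p U (\<lambda>x. c) = 0"
  by (simp add: D_vec_eq[OF has_derivative_const])

lemma D_fun_const [simp]: "U \<in> ctangent_space M p \<Longrightarrow> D_fun M p U (\<lambda>x. c) = 0"
  by (simp add: D_fun_eq[OF has_derivative_const])

lemma D_vec_add_direction:
  assumes "X differentiable (at p within M)"
  shows "D_vec M p (U + W) X = D_vec M p U X + D_vec M p W X"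
  using has_derivative_linear[OF has_derivative_frechet_within[OF assms]]
  by (simp add: D_vec_def linear_add cscale_add_right)

lemma D_vec_cscale_direction:
  assumes "X differentiable (at p within M)"
  shows "D_vec M p (cscale c U) X = cscale c (D_vec M p U X)"
  using has_derivative_linear[OF has_derivative_frechet_within[OF assms]]
  by (simp add: D_vec_def linear_add linear_diff linear_cmul prod_eq_iff algebra_simps)

lemma D_vec_sum_direction:
  assumes "X differentiable (at p within M)"
  shows "D_vec M p (sum f A) X = (\<Sum>i\<in>A. D_vec M p (f i) X)"
proof (induction A rule: infinite_finite_induct)
  case empty
  show ?case using D_vec_cscale_direction[OF assms, of 0 0] by simp
next
  case (infinite A)
  then show ?case using D_vec_cscale_direction[OF assms, of 0 0] by simp
qed (simp add: D_vec_add_direction[OF assms])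

text \<open>The Leibniz rule gives one derivative of the product within \<open>M\<close>, the choice
  operator possibly another; they are known to agree in tangent directions.\<close>

lemma D_fun_gc:
  assumes X: "X differentiable (at p within M)" and Y: "Y differentiable (at p within M)"
    and U: "U \<in> ctangent_space M p"
  shows "D_fun M p U (\<lambda>x. gc (X x) (Y x)) = gc (D_vec M p U X) (Y p) + gc (X p) (D_vec M p U Y)"
  unfolding D_fun_eq[OF bounded_bilinear.FDERIV[OF bounded_bilinear_gc has_derivative_frechet_within[OF X] has_derivative_frechet_within[OF Y]] U]
  by (simp add: D_vec_def gc_simps algebra_simps)

lemma D_vec_Jc:
  assumes X: "X differentiable (at p within M)" and U: "U \<in> ctangent_space M p"
  shows "D_vec M p U (\<lambda>x. Jc (X x)) = Jc (D_vec M p U X)"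
  unfolding D_vec_eq[OF bounded_linear.has_derivative[OF bounded_linear_Jc has_derivative_frechet_within[OF X]] U]
  by (simp add: D_vec_def Jc_add Jc_cscale)

lemma differentiable_bounded_linear:
  assumes "bounded_linear f" "X differentiable F"
  shows "(\<lambda>x. f (X x)) differentiable F"
  using assms bounded_linear.has_derivative unfolding differentiable_def by blast

subsection \<open>Geometry of an oriented hypersurface\<close>

locale hypersurface =
  fixes M :: "(complex^'m::finite) set" and \<nu> :: "complex^'m \<Rightarrow> complex^'m"
  assumes oriented: "oriented_hypersurface M \<nu>"
begin

abbreviation n where "n x \<equiv> of_real_vec (\<nu> x)"
abbreviation T where "T \<equiv> Tfield \<nu>"
abbreviation shape where "shape p W \<equiv> D_vec M p W n"

lemma norm_normal: "p \<in> M \<Longrightarrow> norm (\<nu> p) = 1"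
  and normal_orthogonal: "p \<in> M \<Longrightarrow> v \<in> tangent_space M p \<Longrightarrow> \<nu> p \<bullet> v = 0"
  using oriented unfolding oriented_hypersurface_def by blast+

text \<open>Curves in the level set put the kernel of \<open>d\<rho>_x\<close> into the tangent
  space, hence orthogonal to \<open>\<nu>\<close>. So \<open>\<nu>\<close> lies outside the kernel,
  and subtracting a multiple of \<open>\<nu>\<close> from \<open>v\<close> lands in it, which gives
  the gradient formula. It is stated at all points of \<open>M \<inter> U\<close> because it will be
  differentiated along \<open>M\<close>.\<close>

lemma local_defining_function:
  assumes "p \<in> M"
  obtains U \<rho> where "open U" "p \<in> U" "\<forall>k. Ck_on k U (\<rho> :: complex^'m \<Rightarrow> real)"
    "\<And>x. x \<in> M \<inter> U \<Longrightarrow> frechet_derivative \<rho> (at x) (\<nu> x) \<noteq> 0"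
    "\<And>x v. x \<in> M \<inter> U \<Longrightarrow> frechet_derivative \<rho> (at x) v = frechet_derivative \<rho> (at x) (\<nu> x) * (\<nu> x \<bullet> v)"
    "\<And>x v. x \<in> M \<inter> U \<Longrightarrow> frechet_derivative \<rho> (at x) v = 0 \<Longrightarrow> v \<in> tangent_space M x"
proof -
  have "smooth_hypersurface M" using oriented unfolding oriented_hypersurface_def by blast
  from bspec[OF this[unfolded smooth_hypersurface_def] assms]
  obtain U and \<rho> :: "complex^'m \<Rightarrow> real" where U: "open U" "p \<in> U" and \<rho>: "\<forall>k. Ck_on k U \<rho>"
    and eq: "M \<inter> U = {x \<in> U. \<rho> x = 0}"
    and reg: "\<forall>x\<in>U. \<exists>v. frechet_derivative \<rho> (at x) v \<noteq> 0"
    by (elim exE conjE)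
  have der: "(\<rho> has_derivative frechet_derivative \<rho> (at x)) (at x)" if "x \<in> U" for x
    using Ck_on_all_frechet_derivative(1)[OF U(1) \<rho> that] .
  have kernel: "v \<in> tangent_space M x"
    if x: "x \<in> M \<inter> U" and v: "frechet_derivative \<rho> (at x) v = 0" for x v
  proof -
    obtain w where w: "frechet_derivative \<rho> (at x) w \<noteq> 0" using reg x by blast
    have cont: "continuous_on U \<rho>" using \<rho>[rule_format, of 0] by simp
    have xU: "x \<in> U" "\<rho> x = 0" using x eq by auto
    obtain c \<epsilon> where c: "\<epsilon> > 0" "\<And>t. \<bar>t\<bar> < \<epsilon> \<Longrightarrow> c t \<in> U \<and> \<rho> (c t) = 0" "c 0 = x"
      "(c has_vector_derivative v) (at 0)"
      by (rule level_set_curve[OF U(1) xU(1) cont der[OF xU(1)] xU(2) v w]) blast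
    have "c t \<in> M" if "\<bar>t\<bar> < \<epsilon>" for t using c(2)[OF that] eq by blast
    with c show ?thesis unfolding tangent_space_def by blast
  qed
  have nz: "frechet_derivative \<rho> (at x) (\<nu> x) \<noteq> 0" if "x \<in> M \<inter> U" for x
  proof
    assume "frechet_derivative \<rho> (at x) (\<nu> x) = 0"
    then have "\<nu> x \<bullet> \<nu> x = 0" using kernel[OF that] normal_orthogonal that by blast
    moreover have "norm (\<nu> x) = 1" using norm_normal that by blast
    ultimately show False by simp
  qed
  have "frechet_derivative \<rho> (at x) v = frechet_derivative \<rho> (at x) (\<nu> x) * (\<nu> x \<bullet> v)"
    if x: "x \<in> M \<inter> U" for x v
  proof -
    let ?L = "frechet_derivative \<rho> (at x)"
    have lin: "linear ?L" using der x by (blast intro: has_derivative_linear)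
    have "?L (v - (?L v / ?L (\<nu> x)) *\<^sub>R \<nu> x) = 0"
      using nz[OF x] lin by (simp add: linear_diff linear_cmul)
    then have "\<nu> x \<bullet> (v - (?L v / ?L (\<nu> x)) *\<^sub>R \<nu> x) = 0"
      using kernel[OF x] normal_orthogonal x by blast
    moreover have "\<nu> x \<bullet> \<nu> x = 1" using norm_normal x by (simp add: norm_eq_1)
    ultimately show ?thesis using nz[OF x] by (simp add: inner_diff_right)
  qed
  with U \<rho> nz kernel show thesis using that by blast
qed

lemma tangent_space_eq:
  assumes "p \<in> M"
  shows "tangent_space M p = {v. \<nu> p \<bullet> v = 0}"
proof -
  obtain U and \<rho> :: "complex^'m \<Rightarrow> real" where U: "p \<in> U"
    "\<And>x v. x \<in> M \<inter> U \<Longrightarrow> frechet_derivative \<rho> (at x) v = frechet_derivative \<rho> (at x) (\<nu> x) * (\<nu> x \<bullet> v)"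
    "\<And>x v. x \<in> M \<inter> U \<Longrightarrow> frechet_derivative \<rho> (at x) v = 0 \<Longrightarrow> v \<in> tangent_space M x"
    by (rule local_defining_function[OF assms]) blast
  then have "v \<in> tangent_space M p" if "\<nu> p \<bullet> v = 0" for v
    using assms that by (metis IntI mult_zero_right)
  then show ?thesis using normal_orthogonal[OF assms] by blast
qed

lemma ctangent_space_eq: "p \<in> M \<Longrightarrow> ctangent_space M p = {X. gc X (n p) = 0}"
  by (auto simp: ctangent_space_def tangent_space_eq gc_def complex_eq_iff inner_commute)

lemma gc_normal_normal: "p \<in> M \<Longrightarrow> gc (n p) (n p) = 1"
  using norm_normal by (simp add: gc_def complex_eq_iff norm_eq_1)

lemma normal_differentiable: "p \<in> M \<Longrightarrow> \<nu> differentiable (at p within M)"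
  using oriented smooth_on_imp_differentiable[of M \<nu> M p] unfolding oriented_hypersurface_def by simp

lemma n_differentiable: "p \<in> M \<Longrightarrow> n differentiable (at p within M)"
  using normal_differentiable differentiable_bounded_linear[OF bounded_linear_of_real_vec] by blast

section \<open>The derivative of the normal and the symmetry of \<open>h\<close>\<close>

lemma shape_tangent:
  assumes "p \<in> M" "U \<in> ctangent_space M p"
  shows "shape p U \<in> ctangent_space M p"
proof -
  have "D_fun M p U (\<lambda>x. gc (n x) (n x)) = D_fun M p U (\<lambda>x. 1)"
    by (rule D_fun_cong_openin[of M M]) (use assms gc_normal_normal in auto)
  then have "gc (shape p U) (n p) + gc (n p) (shape p U) = 0"
    using D_fun_gc[OF n_differentiable n_differentiable, OF assms(1,1,2)] assms by simp
  then show ?thesis using assms by (simp add: ctangent_space_eq gc_commute)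
qed

text \<open>Differentiate \<open>d\<rho>\<^sub>x(v) = d\<rho>\<^sub>x(\<nu>\<^sub>x) (\<nu>\<^sub>x \<bullet> v)\<close> along \<open>M\<close> with \<open>v\<close> fixed and tangent at \<open>p\<close>: this identifies
  \<open>d\<rho>(\<nu>) (d\<nu>(u) \<bullet> v)\<close> with the Hessian of \<open>\<rho>\<close>.\<close>

lemma normal_derivative_symmetric:
  assumes p: "p \<in> M" and u: "u \<in> tangent_space M p" and v: "v \<in> tangent_space M p"
  shows "u \<bullet> frechet_derivative \<nu> (at p within M) v = v \<bullet> frechet_derivative \<nu> (at p within M) u"
proof -
  obtain U and \<rho> :: "complex^'m \<Rightarrow> real" where U: "open U" "p \<in> U" and \<rho>: "\<forall>k. Ck_on k U \<rho>"
    and nz: "\<And>x. x \<in> M \<inter> U \<Longrightarrow> frechet_derivative \<rho> (at x) (\<nu> x) \<noteq> 0"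
    and grad: "\<And>x v. x \<in> M \<inter> U \<Longrightarrow> frechet_derivative \<rho> (at x) v = frechet_derivative \<rho> (at x) (\<nu> x) * (\<nu> x \<bullet> v)"
    by (rule local_defining_function[OF p]) blast
  let ?D = "frechet_derivative \<rho>" and ?S = "frechet_derivative \<nu> (at p within M)"
  have op: "openin (top_of_set M) (M \<inter> U)" "p \<in> M \<inter> U" using U p by auto
  have S: "(\<nu> has_derivative ?S) (at p within M)"
    using normal_differentiable[OF p] frechet_derivative_works by blast
  have hess: "frechet_derivative (\<lambda>x. ?D (at x) v) (at p) u = ?D (at p) (\<nu> p) * (v \<bullet> ?S u)"
    if u: "u \<in> tangent_space M p" and v: "v \<in> tangent_space M p" for u v
  proof -
    \<comment> \<open>For tangent \<open>v\<close> the factor \<open>\<nu> p \<bullet> v\<close>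
      vanishes, which removes \<open>\<phi>\<close>, the derivative of
      \<open>d\<rho>(\<nu>)\<close>, from the product rule.\<close>
    define \<phi> where "\<phi> = (\<lambda>h. frechet_derivative (\<lambda>x. ?D (at x) (\<nu> p)) (at p) h + ?D (at p) (?S h))"
    have "((\<lambda>x. ?D (at x) (\<nu> x)) has_derivative \<phi>) (at p within M)"
      unfolding \<phi>_def by (rule has_derivative_frechet_derivative_apply[OF U \<rho> S])
    then have 1: "((\<lambda>x. ?D (at x) (\<nu> x) * (\<nu> x \<bullet> v)) has_derivative
        (\<lambda>h. ?D (at p) (\<nu> p) * (?S h \<bullet> v) + \<phi> h * (\<nu> p \<bullet> v))) (at p within M)"
      by (intro has_derivative_mult has_derivative_inner_left S)
    have 2: "((\<lambda>x. ?D (at x) (\<nu> x) * (\<nu> x \<bullet> v)) has_derivative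
        frechet_derivative (\<lambda>x. ?D (at x) v) (at p)) (at p within M)"
    proof (rule has_derivative_transform_openin[OF _ op])
      show "((\<lambda>x. ?D (at x) v) has_derivative frechet_derivative (\<lambda>x. ?D (at x) v) (at p)) (at p within M)"
        using Ck_on_all_frechet_derivative(1)[OF U(1) Ck_on_all_frechet_derivative(2)[OF U(1) \<rho>] U(2)]
        by (rule has_derivative_at_withinI)
    qed (rule grad)
    have "frechet_derivative (\<lambda>x. ?D (at x) v) (at p) u =
        ?D (at p) (\<nu> p) * (?S u \<bullet> v) + \<phi> u * (\<nu> p \<bullet> v)"
      using frechet_derivative_within_tangent[OF 1 u] frechet_derivative_within_tangent[OF 2 u] by simp
    then show ?thesis using normal_orthogonal[OF p v] by (simp add: inner_commute)
  qed
  have "?D (at p) (\<nu> p) * (u \<bullet> ?S v) = ?D (at p) (\<nu> p) * (v \<bullet> ?S u)"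
    using hess[OF u v] hess[OF v u] second_derivative_symmetric[OF U \<rho>, of v u] by simp
  then show ?thesis using nz[OF op(2)] by simp
qed

lemma shape_eq_Pair:
  assumes p: "p \<in> M" and W: "W \<in> ctangent_space M p"
  shows "shape p W = (frechet_derivative \<nu> (at p within M) (fst W), frechet_derivative \<nu> (at p within M) (snd W))"
proof -
  have "(\<nu> has_derivative frechet_derivative \<nu> (at p within M)) (at p within M)"
    using normal_differentiable[OF p] frechet_derivative_works by blast
  from D_vec_eq[OF bounded_linear.has_derivative[OF bounded_linear_of_real_vec this] W]
  show ?thesis by (simp add: prod_eq_iff)
qed

lemma shape_symmetric:
  assumes "p \<in> M" "X \<in> ctangent_space M p" "Y \<in> ctangent_space M p"
  shows "gc X (shape p Y) = gc Y (shape p X)"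
proof -
  have tan: "fst X \<in> tangent_space M p" "snd X \<in> tangent_space M p"
    "fst Y \<in> tangent_space M p" "snd Y \<in> tangent_space M p"
    using assms(2,3) by (simp_all add: ctangent_space_def mem_Times_iff)
  show ?thesis
    unfolding shape_eq_Pair[OF assms(1,2)] shape_eq_Pair[OF assms(1,3)] gc_def fst_conv snd_conv
      normal_derivative_symmetric[OF assms(1) tan(1) tan(3)] normal_derivative_symmetric[OF assms(1) tan(1) tan(4)]
      normal_derivative_symmetric[OF assms(1) tan(2) tan(3)] normal_derivative_symmetric[OF assms(1) tan(2) tan(4)]
    by (simp add: complex_eq_iff)
qed

lemma sff_symmetric:
  assumes "p \<in> M" "X \<in> ctangent_space M p" "Y \<in> ctangent_space M p"
  shows "sff M \<nu> p X Y = sff M \<nu> p Y X"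
  unfolding sff_def using assms by (rule shape_symmetric)

text \<open>\<open>L\<close> and \<open>Q\<close> are the first and second differentials of a local extension of \<open>\<nu>\<close>. The values of \<open>L\<close> off
  the tangent space depend on the extension, but cancel when the Codazzi identity is alternated.\<close>

lemma derivative_shape:
  assumes p: "p \<in> M"
  obtains L :: "'m cvec \<Rightarrow> 'm cvec" and Q :: "'m cvec \<Rightarrow> 'm cvec \<Rightarrow> 'm cvec" where
    "\<And>X Y. L (X - Y) = L X - L Y" "\<And>X. X \<in> ctangent_space M p \<Longrightarrow> L X = shape p X"
    "\<And>X Y. Q X Y = Q Y X"
    "\<And>V W. openin (top_of_set M) V \<Longrightarrow> p \<in> V \<Longrightarrow> W differentiable (at p within M) \<Longrightarrow>
       (\<And>x. x \<in> V \<Longrightarrow> W x \<in> ctangent_space M x) \<Longrightarrow>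
       (\<lambda>x. shape x (W x)) differentiable (at p within M) \<and>
       (\<forall>U\<in>ctangent_space M p. D_vec M p U (\<lambda>x. shape x (W x)) = Q U (W p) + L (D_vec M p U W))"
proof -
  have "smooth_on M \<nu>" using oriented unfolding oriented_hypersurface_def by blast
  from bspec[OF this[unfolded smooth_on_def] p]
  obtain U0 F where U0: "open U0" "p \<in> U0" and F: "\<forall>k. Ck_on k U0 F" and eq: "\<forall>x\<in>M \<inter> U0. F x = \<nu> x"
    by (elim exE conjE)
  let ?D = "\<lambda>x. frechet_derivative F (at x)"
  define q where "q = (\<lambda>u w. frechet_derivative (\<lambda>x. ?D x w) (at p) u)"
  define L :: "'m cvec \<Rightarrow> 'm cvec" where "L = (\<lambda>X. (?D p (fst X), ?D p (snd X)))"
  define Q :: "'m cvec \<Rightarrow> 'm cvec \<Rightarrow> 'm cvec" where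
    "Q = (\<lambda>U W. (q (fst U) (fst W) - q (snd U) (snd W), q (fst U) (snd W) + q (snd U) (fst W)))"
  have D: "(F has_derivative ?D x) (at x)" if "x \<in> U0" for x
    using Ck_on_all_frechet_derivative(1)[OF U0(1) F that] .
  \<comment> \<open>The differential of the extension is one of the derivatives of
    \<open>\<nu>\<close> within \<open>M\<close>, hence correct on tangent vectors. The identity is
    needed at all nearby points of \<open>M\<close>, since it gets differentiated.\<close>
  have shape_eq: "shape x W = (?D x (fst W), ?D x (snd W))"
    if "x \<in> M \<inter> U0" "W \<in> ctangent_space M x" for x W
  proof -
    have "(\<nu> has_derivative ?D x) (at x within M)"
      by (rule has_derivative_transform_openin[OF has_derivative_at_withinI[OF D], of _ _ "M \<inter> U0"])
         (use that U0 eq in auto)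
    from D_vec_eq[OF bounded_linear.has_derivative[OF bounded_linear_of_real_vec this] that(2)]
    show ?thesis by (simp add: prod_eq_iff)
  qed
  have linD: "linear (?D p)" using D[OF U0(2)] by (rule has_derivative_linear)
  show thesis
  proof (rule that[of L Q])
    show "L (X - Y) = L X - L Y" for X Y
      using linD by (simp add: L_def linear_diff)
    show "L X = shape p X" if "X \<in> ctangent_space M p" for X
      using shape_eq[of p X] that p U0 by (simp add: L_def)
    show "Q X Y = Q Y X" for X Y
      using second_derivative_symmetric[OF U0 F] by (simp add: Q_def q_def)
    fix V and W :: "complex^'m \<Rightarrow> 'm cvec"
    assume V: "openin (top_of_set M) V" "p \<in> V" and W: "W differentiable (at p within M)"
      and WT: "\<And>x. x \<in> V \<Longrightarrow> W x \<in> ctangent_space M x"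
    let ?W = "frechet_derivative W (at p within M)"
    have W': "(W has_derivative ?W) (at p within M)" by (rule has_derivative_frechet_within[OF W])
    define s where "s = (\<lambda>h. (q h (fst (W p)) + ?D p (fst (?W h)), q h (snd (W p)) + ?D p (snd (?W h))))"
    have "((\<lambda>x. (?D x (fst (W x)), ?D x (snd (W x)))) has_derivative s) (at p within M)"
      unfolding s_def q_def
      by (intro has_derivative_Pair has_derivative_frechet_derivative_apply[OF U0 F] has_derivative_fst has_derivative_snd W')
    then have s: "((\<lambda>x. shape x (W x)) has_derivative s) (at p within M)"
    proof (rule has_derivative_transform_openin[of _ _ _ _ "V \<inter> U0"])
      show "(?D x (fst (W x)), ?D x (snd (W x))) = shape x (W x)" if "x \<in> V \<inter> U0" for x
        using shape_eq[of x "W x"] that WT[of x] openin_imp_subset[OF V(1)] by auto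
    qed (use V U0 in \<open>auto intro: openin_Int_open\<close>)
    moreover have "D_vec M p U (\<lambda>x. shape x (W x)) = Q U (W p) + L (D_vec M p U W)"
      if "U \<in> ctangent_space M p" for U
      unfolding D_vec_eq[OF s that]
      by (simp add: s_def D_vec_def Q_def L_def prod_eq_iff linear_add[OF linD] linear_diff[OF linD])
    ultimately show "(\<lambda>x. shape x (W x)) differentiable (at p within M) \<and>
       (\<forall>U\<in>ctangent_space M p. D_vec M p U (\<lambda>x. shape x (W x)) = Q U (W p) + L (D_vec M p U W))"
      unfolding differentiable_def by blast
  qed
qed

section \<open>Splitting of the complexified tangent space\<close>

lemma hol_tangent_iff:
  assumes "x \<in> M"
  shows "W \<in> hol_tangent M x \<longleftrightarrow> gc W (n x) = 0 \<and> Jc W = cscale \<i> W"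
proof -
  have "W \<in> ctangent_space M x \<longleftrightarrow> gc W (n x) = 0" using ctangent_space_eq[OF assms] by blast
  then show ?thesis unfolding hol_tangent_def ctangent_space_def mem_Times_iff by blast
qed

lemma T_eq: "T x = Jc (n x)"
  by (simp add: Tfield_def)

lemma Jc_T: "Jc (T x) = - n x"
  by (simp add: T_eq)

lemma vcnj_T: "vcnj (T x) = T x"
  by (simp add: T_eq Jc_vcnj[symmetric])

lemma gc_T: "gc X (T x) = - gc (Jc X) (n x)"
  by (simp add: T_eq gc_Jc_left)

lemma gc_T_n: "gc (T x) (n x) = 0"
  using gc_T[of "n x" x] gc_commute[of "n x" "T x"] by (simp add: T_eq)

lemma gc_T_T: "x \<in> M \<Longrightarrow> gc (T x) (T x) = 1"
  by (simp add: gc_T Jc_T gc_minus_left gc_normal_normal)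

lemma T_tangent: "x \<in> M \<Longrightarrow> T x \<in> ctangent_space M x"
  by (simp add: ctangent_space_eq gc_T_n)

lemma hol_tangentD:
  assumes "x \<in> M" "W \<in> hol_tangent M x"
  shows "gc W (n x) = 0" "Jc W = cscale \<i> W" "gc W (T x) = 0"
    "gc (vcnj W) (n x) = 0" "Jc (vcnj W) = - cscale \<i> (vcnj W)" "gc (vcnj W) (T x) = 0"
    "W \<in> ctangent_space M x" "vcnj W \<in> ctangent_space M x"
proof -
  show 1: "gc W (n x) = 0" and 2: "Jc W = cscale \<i> W" using assms by (simp_all add: hol_tangent_iff)
  then show 3: "gc W (T x) = 0" by (simp add: gc_T gc_cscale_left)
  show 4: "gc (vcnj W) (n x) = 0" using gc_vcnj[of W "n x"] 1 by simp
  show "gc (vcnj W) (T x) = 0" using gc_vcnj[of W "T x"] 3 by (simp add: vcnj_T)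
  show "Jc (vcnj W) = - cscale \<i> (vcnj W)" by (simp add: Jc_vcnj 2 vcnj_cscale cscale_minus_left)
  show "W \<in> ctangent_space M x" "vcnj W \<in> ctangent_space M x"
    using 1 4 assms by (simp_all add: ctangent_space_eq)
qed

lemma gc_hol_hol:
  assumes "x \<in> M" "W \<in> hol_tangent M x" "W' \<in> hol_tangent M x"
  shows "gc W W' = 0" "gc (vcnj W) (vcnj W') = 0"
proof -
  have "gc (Jc W) W' = - gc W (Jc W')" by (rule gc_Jc_left)
  then show "gc W W' = 0"
    using assms by (simp add: hol_tangentD gc_simps)
  then show "gc (vcnj W) (vcnj W') = 0" by (simp add: gc_vcnj)
qed

lemma zero_hol_tangent: "x \<in> M \<Longrightarrow> 0 \<in> hol_tangent M x"
  by (simp add: hol_tangent_iff)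

text \<open>Pairing with \<open>T\<close> isolates \<open>f\<close>. Then \<open>- i J\<close> fixes
  the holomorphic part and negates the conjugate one, so adding the two equations isolates
  \<open>Z\<close>.\<close>

lemma decomposition_unique:
  assumes x: "x \<in> M" and H: "Z \<in> hol_tangent M x" "W \<in> hol_tangent M x" "Z' \<in> hol_tangent M x" "W' \<in> hol_tangent M x"
    and eq: "Z + vcnj W + cscale f (T x) = Z' + vcnj W' + cscale f' (T x)"
  shows "Z = Z' \<and> vcnj W = vcnj W' \<and> f = f'"
proof -
  from arg_cong[OF eq, of "\<lambda>X. gc X (T x)"] have f: "f = f'"
    using x H by (simp add: gc_simps hol_tangentD gc_T_T)
  with eq have 1: "Z + vcnj W = Z' + vcnj W'" by simp
  from arg_cong[OF this, of "\<lambda>X. cscale (- \<i>) (Jc X)"] have "Z - vcnj W = Z' - vcnj W'"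
    using x H by (simp add: Jc_add hol_tangentD cscale_simps)
  with 1 have "(Z + vcnj W) + (Z - vcnj W) = (Z' + vcnj W') + (Z' - vcnj W')" by simp
  then have "2 *\<^sub>R Z = 2 *\<^sub>R Z'" by (simp add: scaleR_2)
  then have "Z = Z'" by simp
  with 1 f show ?thesis by simp
qed

lemma decomposition_exists:
  assumes x: "x \<in> M" and X: "X \<in> ctangent_space M x"
  obtains Z W f where "Z \<in> hol_tangent M x" "W \<in> hol_tangent M x" "X = Z + vcnj W + cscale f (T x)"
proof -
  define f where "f = gc X (T x)"
  define Y where "Y = X - cscale f (T x)"
  have Xn: "gc X (n x) = 0" using X x by (simp add: ctangent_space_eq)
  have Yn: "gc Y (n x) = 0" unfolding Y_def gc_diff_left gc_cscale_left gc_T_n Xn by simp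
  have "gc Y (T x) = 0" unfolding Y_def gc_diff_left gc_cscale_left gc_T_T[OF x] f_def by simp
  then have YT: "gc (Jc Y) (n x) = 0" unfolding gc_T by simp
  \<comment> \<open>With the \<open>T\<close> part removed, \<open>J Y\<close> is tangent as well,
    and \<open>(1 - i J) / 2\<close> and \<open>(1 + i J) / 2\<close> project onto the eigenspaces
    of \<open>J\<close> for \<open>i\<close> and \<open>- i\<close>.\<close>
  define P where "P = cscale (1/2) (Y - cscale \<i> (Jc Y))"
  define R where "R = cscale (1/2) (Y + cscale \<i> (Jc Y))"
  have "P \<in> hol_tangent M x"
    using x Yn YT by (simp add: hol_tangent_iff P_def gc_simps Jc_cscale Jc_diff cscale_simps)
  moreover have "vcnj R \<in> hol_tangent M x"
  proof -
    have "gc R (n x) = 0" using Yn YT by (simp add: R_def gc_simps)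
    moreover have "Jc R = - cscale \<i> R" by (simp add: R_def Jc_cscale Jc_add cscale_simps)
    ultimately show ?thesis
      using x gc_vcnj[of R "n x"] by (simp add: hol_tangent_iff Jc_vcnj vcnj_minus vcnj_cscale cscale_simps)
  qed
  moreover have "X = P + vcnj (vcnj R) + cscale f (T x)"
  proof -
    have "P + R = cscale (1/2) Y + cscale (1/2) Y" by (simp add: P_def R_def cscale_simps)
    also have "\<dots> = Y" by (simp flip: cscale_add_left)
    finally show ?thesis by (simp add: Y_def)
  qed
  ultimately show thesis using that by blast
qed

lemma parts_eq:
  assumes x: "x \<in> M" and H: "Z \<in> hol_tangent M x" "W \<in> hol_tangent M x"
    and X: "X = Z + vcnj W + cscale f (T x)"
  shows "hol_part M \<nu> x X = Z" "antihol_part M \<nu> x X = vcnj W" "T_part M \<nu> x X = f"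
proof -
  note uniq = decomposition_unique[OF x _ _ H, of _ _ _ f]
  show "hol_part M \<nu> x X = Z"
    unfolding hol_part_def
  proof (rule the_equality)
    show "Z \<in> hol_tangent M x \<and> (\<exists>W\<in>hol_tangent M x. \<exists>f. X = Z + vcnj W + cscale f (T x))"
      using H X by blast
  qed (use uniq X in auto)
  show "antihol_part M \<nu> x X = vcnj W"
    unfolding antihol_part_def
  proof (rule the_equality)
    show "vcnj W \<in> vcnj ` hol_tangent M x \<and> (\<exists>Z\<in>hol_tangent M x. \<exists>f. X = Z + vcnj W + cscale f (T x))"
      using H X by blast
  qed (use uniq X in auto)
  show "T_part M \<nu> x X = f"
    unfolding T_part_def
  proof (rule the_equality)
    show "\<exists>Z\<in>hol_tangent M x. \<exists>W\<in>hol_tangent M x. X = Z + vcnj W + cscale f (T x)"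
      using H X by blast
  qed (use uniq X in auto)
qed

section \<open>Gauss formulas\<close>

text \<open>Differentiate \<open>g(X, \<nu>) = 0\<close> and \<open>g(X, T) = 0\<close> along
  \<open>M\<close>; in the second, \<open>D T = J (D \<nu>)\<close> and skewness moves
  \<open>J\<close> onto \<open>X\<close>. For eigenvectors of \<open>J\<close> both components are
  thus multiples of \<open>h\<close>.\<close>

lemma gc_D_vec_orthogonal:
  assumes V: "openin (top_of_set M) V" "x \<in> V" and X: "X differentiable (at x within M)"
    and orth: "\<And>y. y \<in> V \<Longrightarrow> gc (X y) (n y) = 0" "\<And>y. y \<in> V \<Longrightarrow> gc (X y) (T y) = 0"
    and U: "U \<in> ctangent_space M x"
  shows "gc (D_vec M x U X) (n x) = - gc (X x) (shape x U)"
    "gc (D_vec M x U X) (T x) = gc (Jc (X x)) (shape x U)"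
proof -
  have xM: "x \<in> M" using V openin_imp_subset by blast
  have T: "T differentiable (at x within M)"
    unfolding T_eq by (rule differentiable_bounded_linear[OF bounded_linear_Jc n_differentiable[OF xM]])
  have DT: "D_vec M x U T = Jc (shape x U)"
    unfolding T_eq by (rule D_vec_Jc[OF n_differentiable[OF xM] U])
  have "D_fun M x U (\<lambda>y. gc (X y) (n y)) = D_fun M x U (\<lambda>y. 0)"
    by (rule D_fun_cong_openin[OF V]) (rule orth)
  then show "gc (D_vec M x U X) (n x) = - gc (X x) (shape x U)"
    unfolding D_fun_gc[OF X n_differentiable[OF xM] U] using U by (simp add: add_eq_0_iff2)
  have "D_fun M x U (\<lambda>y. gc (X y) (T y)) = D_fun M x U (\<lambda>y. 0)"
    by (rule D_fun_cong_openin[OF V]) (rule orth)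
  then show "gc (D_vec M x U X) (T x) = gc (Jc (X x)) (shape x U)"
    unfolding D_fun_gc[OF X T U] using U by (simp add: DT gc_Jc_left add_eq_0_iff2)
qed

lemma sqrt2_cancel: "complex_of_real (1 / sqrt 2) * complex_of_real (1 / sqrt 2) = 1 / 2"
proof -
  have "complex_of_real (1 / sqrt 2) * complex_of_real (1 / sqrt 2) = complex_of_real (1 / sqrt 2 * (1 / sqrt 2))"
    by (rule of_real_mult[symmetric])
  also have "1 / sqrt 2 * (1 / sqrt 2) = (1 / 2 :: real)" by simp
  finally show ?thesis by simp
qed

lemma gauss_hol:
  assumes V: "openin (top_of_set M) V" "x \<in> V" and X: "X differentiable (at x within M)"
    and H: "\<And>y. y \<in> V \<Longrightarrow> X y \<in> hol_tangent M y" and U: "U \<in> ctangent_space M x"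
  shows "D_vec M x U X - nabla M \<nu> x U X = - cscale (sff M \<nu> x (X x) U) (n x - cscale \<i> (T x))"
proof -
  have VM: "V \<subseteq> M" using V openin_imp_subset by blast
  have parts: "hol_part M \<nu> y (X y) = X y" "antihol_part M \<nu> y (X y) = 0" "T_part M \<nu> y (X y) = 0"
    if "y \<in> V" for y
    using parts_eq[of y "X y" 0 "X y" 0] H[OF that] that VM zero_hol_tangent by auto
  have 1: "D_vec M x U (\<lambda>y. hol_part M \<nu> y (X y)) = D_vec M x U X"
    by (rule D_vec_cong_openin[OF V]) (rule parts)
  have "D_vec M x U (\<lambda>y. antihol_part M \<nu> y (X y)) = D_vec M x U (\<lambda>y. 0)"
    by (rule D_vec_cong_openin[OF V]) (rule parts)
  then have 2: "D_vec M x U (\<lambda>y. antihol_part M \<nu> y (X y)) = 0" using U by simp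
  have "D_fun M x U (\<lambda>y. T_part M \<nu> y (X y)) = D_fun M x U (\<lambda>y. 0)"
    by (rule D_fun_cong_openin[OF V]) (rule parts)
  then have 3: "D_fun M x U (\<lambda>y. T_part M \<nu> y (X y)) = 0" using U by simp
  have g: "gc (D_vec M x U X) (n x) = - gc (X x) (shape x U)"
    "gc (D_vec M x U X) (T x) = gc (Jc (X x)) (shape x U)"
    using gc_D_vec_orthogonal[OF V X _ _ U] H VM by (auto simp: hol_tangentD subset_iff)
  have J: "Jc (X x) = cscale \<i> (X x)" using H V(2) VM hol_tangentD by blast
  \<comment> \<open>Since \<open>J X = i X\<close>, the \<open>\<nu>\<close> part and the
    \<open>T\<close> part of the conjugate of \<open>N\<close> each contribute
    \<open>- h(X, U)\<close>; the two factors \<open>1 / sqrt 2\<close> then absorb the 2.\<close>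
  have "gc (D_vec M x U X) (vcnj (Nfield \<nu> x)) = complex_of_real (1 / sqrt 2) * (- 2 * sff M \<nu> x (X x) U)"
    by (simp add: Nfield_def vcnj_cscale vcnj_diff vcnj_T gc_simps g J sff_def)
  then have "cscale (gc (D_vec M x U X) (vcnj (Nfield \<nu> x))) (Nfield \<nu> x) =
      cscale ((complex_of_real (1 / sqrt 2) * complex_of_real (1 / sqrt 2)) * (- 2 * sff M \<nu> x (X x) U)) (n x - cscale \<i> (T x))"
    by (simp add: Nfield_def mult_ac)
  then have "cscale (gc (D_vec M x U X) (vcnj (Nfield \<nu> x))) (Nfield \<nu> x) =
      - cscale (sff M \<nu> x (X x) U) (n x - cscale \<i> (T x))"
    unfolding sqrt2_cancel by (simp add: cscale_minus_left)
  then show ?thesis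
    unfolding nabla_def Let_def 1 2 3 by simp
qed

text \<open>The conjugate counterpart: \<open>N\<close> and its conjugate are exchanged and
  \<open>J\<close> acts on \<open>X\<close> by \<open>- i\<close>, so only the \<open>T\<close> part
  of the defect changes sign.\<close>

lemma gauss_antihol:
  assumes V: "openin (top_of_set M) V" "x \<in> V" and X: "X differentiable (at x within M)"
    and H: "\<And>y. y \<in> V \<Longrightarrow> vcnj (X y) \<in> hol_tangent M y" and U: "U \<in> ctangent_space M x"
  shows "D_vec M x U X - nabla M \<nu> x U X = - cscale (sff M \<nu> x (X x) U) (n x + cscale \<i> (T x))"
proof -
  have VM: "V \<subseteq> M" using V openin_imp_subset by blast
  have parts: "hol_part M \<nu> y (X y) = 0" "antihol_part M \<nu> y (X y) = X y" "T_part M \<nu> y (X y) = 0"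
    if "y \<in> V" for y
    using parts_eq[of y 0 "vcnj (X y)" "X y" 0] H[OF that] that VM zero_hol_tangent by auto
  have "D_vec M x U (\<lambda>y. hol_part M \<nu> y (X y)) = D_vec M x U (\<lambda>y. 0)"
    by (rule D_vec_cong_openin[OF V]) (rule parts)
  then have 1: "D_vec M x U (\<lambda>y. hol_part M \<nu> y (X y)) = 0" using U by simp
  have 2: "D_vec M x U (\<lambda>y. antihol_part M \<nu> y (X y)) = D_vec M x U X"
    by (rule D_vec_cong_openin[OF V]) (rule parts)
  have "D_fun M x U (\<lambda>y. T_part M \<nu> y (X y)) = D_fun M x U (\<lambda>y. 0)"
    by (rule D_fun_cong_openin[OF V]) (rule parts)
  then have 3: "D_fun M x U (\<lambda>y. T_part M \<nu> y (X y)) = 0" using U by simp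
  have orth: "gc (X y) (n y) = 0" "gc (X y) (T y) = 0" "Jc (X y) = - cscale \<i> (X y)" if "y \<in> V" for y
    using hol_tangentD(4-6)[OF _ H[OF that]] that VM by auto
  note g = gc_D_vec_orthogonal[OF V X orth(1,2) U]
  have "gc (D_vec M x U X) (Nfield \<nu> x) = complex_of_real (1 / sqrt 2) * (- 2 * sff M \<nu> x (X x) U)"
    by (simp add: Nfield_def gc_simps g orth(3)[OF V(2)] sff_def)
  then have "cscale (gc (D_vec M x U X) (Nfield \<nu> x)) (vcnj (Nfield \<nu> x)) =
      cscale ((complex_of_real (1 / sqrt 2) * complex_of_real (1 / sqrt 2)) * (- 2 * sff M \<nu> x (X x) U)) (n x + cscale \<i> (T x))"
    by (simp add: Nfield_def vcnj_cscale vcnj_diff vcnj_T cscale_minus_left mult_ac)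
  then have "cscale (gc (D_vec M x U X) (Nfield \<nu> x)) (vcnj (Nfield \<nu> x)) =
      - cscale (sff M \<nu> x (X x) U) (n x + cscale \<i> (T x))"
    unfolding sqrt2_cancel by (simp add: cscale_minus_left)
  then show ?thesis
    unfolding nabla_def Let_def 1 2 3 by simp
qed

lemma nabla_T:
  assumes x: "x \<in> M" and U: "U \<in> ctangent_space M x"
  shows "nabla M \<nu> x U T = 0"
proof -
  have V: "openin (top_of_set M) M" "x \<in> M" using x by auto
  have parts: "hol_part M \<nu> y (T y) = 0" "antihol_part M \<nu> y (T y) = 0" "T_part M \<nu> y (T y) = 1"
    if "y \<in> M" for y
    using parts_eq[of y 0 0 "T y" 1] that zero_hol_tangent by auto
  have "D_vec M x U (\<lambda>y. hol_part M \<nu> y (T y)) = D_vec M x U (\<lambda>y. 0)"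
    "D_vec M x U (\<lambda>y. antihol_part M \<nu> y (T y)) = D_vec M x U (\<lambda>y. 0)"
    "D_fun M x U (\<lambda>y. T_part M \<nu> y (T y)) = D_fun M x U (\<lambda>y. 1)"
    by (rule D_vec_cong_openin[OF V] D_fun_cong_openin[OF V], rule parts, assumption)+
  then show ?thesis using U by (simp add: nabla_def)
qed

lemma gauss_T:
  assumes x: "x \<in> M" and U: "U \<in> ctangent_space M x"
  shows "D_vec M x U T - nabla M \<nu> x U T = Jc (shape x U)"
  unfolding nabla_T[OF x U] T_eq D_vec_Jc[OF n_differentiable[OF x] U] by simp

section \<open>The Codazzi identity for a connection with torsion\<close>

text \<open>The tangent vectors \<open>nabla Y\<close> and \<open>nabla W\<close> allow
  \<open>shape\<close> to be replaced by \<open>L\<close>, which also accepts the possibly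
  non-tangent \<open>D Y\<close> and \<open>D W\<close>. Alternation cancels \<open>Q\<close> and
  leaves \<open>L\<close> of minus the torsion of \<open>nabla\<close>; its tangency turns
  \<open>L\<close> back into \<open>shape\<close>.\<close>

lemma codazzi:
  assumes V: "openin (top_of_set M) V" "x \<in> V"
    and diff: "X differentiable (at x within M)" "Y differentiable (at x within M)" "W differentiable (at x within M)"
    and tan: "\<And>y. y \<in> V \<Longrightarrow> Y y \<in> ctangent_space M y" "\<And>y. y \<in> V \<Longrightarrow> W y \<in> ctangent_space M y"
    and nab: "nabla M \<nu> x (W x) Y \<in> ctangent_space M x" "nabla M \<nu> x (Y x) W \<in> ctangent_space M x"
    and torsion: "(D_vec M x (W x) Y - nabla M \<nu> x (W x) Y) - (D_vec M x (Y x) W - nabla M \<nu> x (Y x) W)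
      \<in> ctangent_space M x"
  shows "nabla_sff M \<nu> x (W x) X Y - nabla_sff M \<nu> x (Y x) X W =
    gc (D_vec M x (W x) X - nabla M \<nu> x (W x) X) (shape x (Y x))
    - gc (D_vec M x (Y x) X - nabla M \<nu> x (Y x) X) (shape x (W x))
    + sff M \<nu> x (X x) ((D_vec M x (W x) Y - nabla M \<nu> x (W x) Y) - (D_vec M x (Y x) W - nabla M \<nu> x (Y x) W))"
proof -
  have x: "x \<in> M" using V openin_imp_subset by blast
  obtain L Q where L: "\<And>X Y. L (X - Y) = L X - L Y" "\<And>X. X \<in> ctangent_space M x \<Longrightarrow> L X = shape x X"
    and Q: "\<And>X Y. Q X Y = Q Y X"
    and D: "\<And>V W. openin (top_of_set M) V \<Longrightarrow> x \<in> V \<Longrightarrow> W differentiable (at x within M) \<Longrightarrow>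
       (\<And>y. y \<in> V \<Longrightarrow> W y \<in> ctangent_space M y) \<Longrightarrow>
       (\<lambda>y. shape y (W y)) differentiable (at x within M) \<and>
       (\<forall>U\<in>ctangent_space M x. D_vec M x U (\<lambda>y. shape y (W y)) = Q U (W x) + L (D_vec M x U W))"
    by (rule derivative_shape[OF x]) blast
  have main: "nabla_sff M \<nu> x U X B =
      gc (D_vec M x U X - nabla M \<nu> x U X) (shape x (B x)) + gc (X x) (Q U (B x))
      + gc (X x) (L (D_vec M x U B - nabla M \<nu> x U B))"
    if B: "B differentiable (at x within M)" "\<And>y. y \<in> V \<Longrightarrow> B y \<in> ctangent_space M y"
      and U: "U \<in> ctangent_space M x" and nU: "nabla M \<nu> x U B \<in> ctangent_space M x" for U B
  proof -
    have dB: "(\<lambda>y. shape y (B y)) differentiable (at x within M)"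
      "D_vec M x U (\<lambda>y. shape y (B y)) = Q U (B x) + L (D_vec M x U B)"
      using D[OF V B] U by blast+
    show ?thesis
      unfolding nabla_sff_def sff_def D_fun_gc[OF diff(1) dB(1) U] dB(2)
      by (simp add: gc_simps L nU)
  qed
  have YW: "Y x \<in> ctangent_space M x" "W x \<in> ctangent_space M x" using tan V(2) by blast+
  have m: "nabla_sff M \<nu> x (W x) X Y =
      gc (D_vec M x (W x) X - nabla M \<nu> x (W x) X) (shape x (Y x)) + gc (X x) (Q (W x) (Y x))
      + gc (X x) (L (D_vec M x (W x) Y - nabla M \<nu> x (W x) Y))"
    "nabla_sff M \<nu> x (Y x) X W =
      gc (D_vec M x (Y x) X - nabla M \<nu> x (Y x) X) (shape x (W x)) + gc (X x) (Q (Y x) (W x))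
      + gc (X x) (L (D_vec M x (Y x) W - nabla M \<nu> x (Y x) W))"
    using diff tan YW nab by (auto intro!: main)
  show ?thesis
    unfolding m
    by (simp add: sff_def L(2)[OF torsion, symmetric] L(1)[of "D_vec M x (W x) Y - nabla M \<nu> x (W x) Y"]
        gc_diff_right[of "X x" "L _" "L _"] Q[of "W x" "Y x"])
qed

end

text \<open>With \<open>A\<close> the transpose of \<open>g\<close>, the equation defining
  \<open>g_inv\<close> reads \<open>G ** A = mat 1\<close>, and nondegeneracy says that
  \<open>A\<close> has trivial kernel. The second claim is \<open>A ** G = mat 1\<close>, needed
  because raising to a barred index contracts the other index of \<open>g_inv\<close>.\<close>

lemma matrix_inverse_indexed:
  fixes g :: "'n::finite \<Rightarrow> 'n \<Rightarrow> complex"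
  assumes nondeg: "\<And>c. (\<And>b. (\<Sum>a\<in>UNIV. c a * g a b) = 0) \<Longrightarrow> c = (\<lambda>_. 0)"
  shows "\<exists>!G. \<forall>a c. (\<Sum>b\<in>UNIV. G a b * g c b) = (if a = c then 1 else 0)"
    and "(\<forall>a c. (\<Sum>b\<in>UNIV. G a b * g c b) = (if a = c then 1 else 0)) \<Longrightarrow>
      (\<Sum>b\<in>UNIV. G b a * g b c) = (if a = c then 1 else 0)"
proof -
  define A :: "complex^'n^'n" where "A = (\<chi> b a. g a b)"
  have left: "(\<chi> a b. G a b) ** A = mat 1 \<longleftrightarrow> (\<forall>a c. (\<Sum>b\<in>UNIV. G a b * g c b) = (if a = c then 1 else 0))" for G
    by (simp add: A_def matrix_matrix_mult_def mat_def vec_eq_iff)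
  have right: "A ** (\<chi> a b. G a b) = mat 1 \<longleftrightarrow> (\<forall>c a. (\<Sum>b\<in>UNIV. G b a * g b c) = (if c = a then 1 else 0))" for G
    by (simp add: A_def matrix_matrix_mult_def mat_def vec_eq_iff mult.commute)
  have "\<exists>B. B ** A = mat 1"
  proof -
    have "x = 0" if "A *v x = 0" for x
    proof -
      have "(\<lambda>a. x $ a) = (\<lambda>_. 0)"
        using that by (intro nondeg) (simp add: A_def matrix_vector_mult_def vec_eq_iff mult.commute)
      then show ?thesis by (simp add: vec_eq_iff fun_eq_iff)
    qed
    then show ?thesis by (simp add: matrix_left_invertible_ker)
  qed
  then obtain B where B: "B ** A = mat 1" by blast
  then have B': "A ** B = mat 1" by (simp add: matrix_left_right_inverse)
  show "\<exists>!G. \<forall>a c. (\<Sum>b\<in>UNIV. G a b * g c b) = (if a = c then 1 else 0)"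
  proof (rule ex1I[of _ "\<lambda>a b. B $ a $ b"])
    show "\<forall>a c. (\<Sum>b\<in>UNIV. B $ a $ b * g c b) = (if a = c then 1 else 0)"
      using B unfolding left[symmetric] by simp
    fix G assume "\<forall>a c. (\<Sum>b\<in>UNIV. G a b * g c b) = (if a = c then 1 else 0)"
    then have "(\<chi> a b. G a b) ** A = mat 1" by (rule iffD2[OF left])
    then have "((\<chi> a b. G a b) ** A) ** B = B" by simp
    then have "(\<chi> a b. G a b) = B" by (simp only: matrix_mul_assoc[symmetric] B' matrix_mul_rid)
    then show "G = (\<lambda>a b. B $ a $ b)" by (auto simp: vec_eq_iff)
  qed
  assume "\<forall>a c. (\<Sum>b\<in>UNIV. G a b * g c b) = (if a = c then 1 else 0)"
  then have "(\<chi> a b. G a b) ** A = mat 1" by (rule iffD2[OF left])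
  then have "A ** (\<chi> a b. G a b) = mat 1" by (rule iffD1[OF matrix_left_right_inverse])
  from iffD1[OF right this, rule_format, of a c]
  show "(\<Sum>b\<in>UNIV. G b a * g b c) = (if a = c then 1 else 0)" by (simp only: eq_commute[of c])
qed

subsection \<open>The Codazzi equations in a holomorphic frame\<close>

locale framed_hypersurface = hypersurface M \<nu> for M :: "(complex^'m::finite) set" and \<nu> +
  fixes V :: "(complex^'m) set" and Z :: "'n::finite \<Rightarrow> complex^'m \<Rightarrow> 'm cvec" and p :: "complex^'m"
  assumes hol_frame: "hol_frame M V Z" and p: "p \<in> V"
begin

abbreviation fr where "fr \<equiv> frame \<nu> Z"
abbreviation h where "h \<equiv> h_comp M \<nu> Z p"
abbreviation dh where "dh \<equiv> nabla_h_comp M \<nu> Z p"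
abbreviation hup where "hup \<equiv> h_up M \<nu> Z p"
abbreviation hupbar where "hupbar \<equiv> h_up_bar M \<nu> Z p"
abbreviation S where "S A \<equiv> shape p (fr A p)"

lemma V_open: "openin (top_of_set M) V"
  using hol_frame by (simp add: hol_frame_def)

lemma V_subset: "y \<in> V \<Longrightarrow> y \<in> M"
  using V_open openin_imp_subset by blast

lemma p_in_M: "p \<in> M"
  using p by (rule V_subset)

lemma Z_hol: "y \<in> V \<Longrightarrow> Z a y \<in> hol_tangent M y"
  using hol_frame by (simp add: hol_frame_def)

lemma frame_tangent: "y \<in> V \<Longrightarrow> fr A y \<in> ctangent_space M y"
  using hol_tangentD(7,8)[OF V_subset Z_hol] T_tangent[OF V_subset] by (cases A) auto

lemma frame_differentiable: "fr A differentiable (at p within M)"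
proof -
  have Z: "Z a differentiable (at p within M)" for a
    using hol_frame p by (intro smooth_on_imp_differentiable[of V]) (auto simp: hol_frame_def)
  show ?thesis
  proof (cases A)
    case (Hol a)
    then have "fr A = Z a" by (simp add: fun_eq_iff)
    with Z show ?thesis by simp
  next
    case (Bar a)
    then have "fr A = (\<lambda>x. vcnj (Z a x))" by (simp add: fun_eq_iff)
    with differentiable_bounded_linear[OF bounded_linear_vcnj Z[of a]] show ?thesis by simp
  next
    case Zero
    then have "fr A = (\<lambda>x. Jc (n x))" by (simp add: fun_eq_iff T_eq)
    with differentiable_bounded_linear[OF bounded_linear_Jc n_differentiable[OF p_in_M]] show ?thesis by simp
  qed
qed

lemma h_eq: "h A B = gc (fr A p) (S B)"
  by (simp add: h_comp_def sff_def)

lemma h_commute: "h A B = h B A"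
  unfolding h_comp_def using p p_in_M by (intro sff_symmetric frame_tangent)

definition gauss_defect :: "'n frame_index \<Rightarrow> 'n frame_index \<Rightarrow> 'm cvec" where
  "gauss_defect C A = D_vec M p (fr C p) (fr A) - nabla M \<nu> p (fr C p) (fr A)"

lemma gauss_defect_Hol: "gauss_defect C (Hol a) = - cscale (h (Hol a) C) (n p - cscale \<i> (T p))"
proof -
  have "fr (Hol a) = Z a" by (simp add: fun_eq_iff)
  then show ?thesis
    using gauss_hol[OF V_open p frame_differentiable[of "Hol a"] _ frame_tangent[OF p, of C]] Z_hol
    by (simp add: gauss_defect_def h_comp_def)
qed

lemma gauss_defect_Bar: "gauss_defect C (Bar a) = - cscale (h (Bar a) C) (n p + cscale \<i> (T p))"
  using gauss_antihol[OF V_open p frame_differentiable[of "Bar a"] _ frame_tangent[OF p, of C]] Z_hol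
  by (simp add: gauss_defect_def h_comp_def)

lemma gauss_defect_Zero: "gauss_defect C Zero = Jc (S C)"
proof -
  have "fr Zero = T" by (simp add: fun_eq_iff)
  then show ?thesis
    using gauss_T[OF p_in_M frame_tangent[OF p, of C]] by (simp add: gauss_defect_def)
qed

lemma S_tangent: "gc (S A) (n p) = 0"
  using shape_tangent[OF p_in_M frame_tangent[OF p]] ctangent_space_eq[OF p_in_M] by blast

lemma gc_n_S: "gc (n p) (S A) = 0"
  using S_tangent by (simp add: gc_commute)

lemma gc_T_S: "gc (T p) (S A) = h Zero A"
  by (simp add: h_eq)

text \<open>Apart from \<open>T\<close>, which is parallel, the flat derivative and the Gauss defect
  both have normal component \<open>- h A C\<close>, so it drops out of their difference.\<close>

lemma nabla_tangent: "nabla M \<nu> p (fr C p) (fr A) \<in> ctangent_space M p"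
proof (cases "A = Zero")
  case True
  have "fr Zero = T" by (simp add: fun_eq_iff)
  with True show ?thesis
    using nabla_T[OF p_in_M frame_tangent[OF p, of C]] ctangent_space_eq[OF p_in_M] by simp
next
  case False
  have orth: "gc (fr A y) (n y) = 0" "gc (fr A y) (T y) = 0" if "y \<in> V" for y
    using False hol_tangentD[OF V_subset[OF that] Z_hol[OF that]] by (cases A; simp)+
  have "gc (D_vec M p (fr C p) (fr A)) (n p) = - h A C"
    using gc_D_vec_orthogonal(1)[OF V_open p frame_differentiable orth frame_tangent[OF p]] by (simp add: h_eq)
  moreover have "gc (gauss_defect C A) (n p) = - h A C"
    using False gc_normal_normal[OF p_in_M] gc_T_n
    by (cases A) (simp_all add: gauss_defect_Hol gauss_defect_Bar gc_simps)
  ultimately show ?thesis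
    by (simp add: gauss_defect_def gc_simps ctangent_space_eq[OF p_in_M])
qed

lemma codazzi_frame:
  assumes "gauss_defect C B - gauss_defect B C = Y" "Y \<in> ctangent_space M p"
  shows "dh C A B - dh B A C =
    gc (gauss_defect C A) (S B) - gc (gauss_defect B A) (S C) + gc (fr A p) (shape p Y)"
  unfolding nabla_h_comp_def assms(1)[symmetric] gauss_defect_def
  using codazzi[OF V_open p frame_differentiable frame_differentiable frame_differentiable
      frame_tangent frame_tangent nabla_tangent nabla_tangent, of C B A] assms
  by (simp add: sff_def gauss_defect_def)

section \<open>Raised indices and the components of the derivative of the normal\<close>

text \<open>Such coefficients define a holomorphic vector orthogonal to all conjugate frame vectors,
  hence to its own conjugate. Positivity makes it zero, and frame coefficients are unique.\<close>

lemma g_comp_nondegenerate: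
  assumes "\<And>b. (\<Sum>a\<in>UNIV. c a * g_comp Z p a b) = 0"
  shows "c = (\<lambda>_. 0)"
proof -
  let ?X = "\<Sum>a\<in>UNIV. cscale (c a) (Z a p)"
  have "gc ?X (vcnj (Z b p)) = 0" for b
    using assms[of b] by (simp add: gc_sum_left gc_cscale_left g_comp_def)
  then have "gc ?X (vcnj ?X) = 0"
    by (simp add: gc_sum_right vcnj_sum vcnj_cscale gc_cscale_right)
  then have X: "?X = 0" by (simp add: gc_vcnj_self_eq_zero_iff)
  have "\<forall>W\<in>hol_tangent M p. \<exists>!c. W = (\<Sum>a\<in>UNIV. cscale (c a) (Z a p))"
    using hol_frame p unfolding hol_frame_def by blast
  from bspec[OF this zero_hol_tangent[OF p_in_M]]
  have unique: "\<exists>!c. 0 = (\<Sum>a\<in>UNIV. cscale (c a) (Z a p))" .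
  have "c = (THE c. 0 = (\<Sum>a\<in>UNIV. cscale (c a) (Z a p)))"
    by (rule the1_equality[OF unique, symmetric]) (rule X[symmetric])
  also have "\<dots> = (\<lambda>_. 0)" by (rule the1_equality[OF unique]) simp
  finally show ?thesis .
qed

lemma g_inv_left: "(\<Sum>b\<in>UNIV. g_inv Z p a b * g_comp Z p c b) = (if a = c then 1 else 0)"
  using theI'[OF matrix_inverse_indexed(1)[of "g_comp Z p", OF g_comp_nondegenerate]]
  unfolding g_inv_def by blast

lemma g_inv_right: "(\<Sum>b\<in>UNIV. g_inv Z p b a * g_comp Z p b c) = (if a = c then 1 else 0)"
  by (rule matrix_inverse_indexed(2)[of "g_comp Z p", OF g_comp_nondegenerate]) (simp_all add: g_inv_left)

definition S_hol :: "'n frame_index \<Rightarrow> 'm cvec" where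
  "S_hol A = (\<Sum>l\<in>UNIV. cscale (hup A l) (Z l p))"

definition S_antihol :: "'n frame_index \<Rightarrow> 'm cvec" where
  "S_antihol A = (\<Sum>l\<in>UNIV. cscale (hupbar A l) (vcnj (Z l p)))"

text \<open>The holomorphic space and its conjugate are isotropic and orthogonal to
  \<open>T\<close>, so pairing with a conjugate frame vector sees only the holomorphic part, through
  the matrix \<open>g_comp\<close>, and \<open>g_inv\<close> recovers its coefficients. The
  conjugate part uses the inverse on the other side.\<close>

lemma S_expand: "S A = S_hol A + S_antihol A + cscale (h Zero A) (T p)"
proof -
  obtain X Y f where X: "X \<in> hol_tangent M p" and Y: "Y \<in> hol_tangent M p"
    and S: "S A = X + vcnj Y + cscale f (T p)"
    using decomposition_exists[OF p_in_M shape_tangent[OF p_in_M frame_tangent[OF p]]] by metis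
  obtain a where a: "X = (\<Sum>l\<in>UNIV. cscale (a l) (Z l p))"
    using hol_frame p X unfolding hol_frame_def by blast
  obtain b where b: "Y = (\<Sum>l\<in>UNIV. cscale (b l) (Z l p))"
    using hol_frame p Y unfolding hol_frame_def by blast
  note H = hol_tangentD[OF p_in_M] gc_hol_hol[OF p_in_M]
  have hBar: "h A (Bar m) = (\<Sum>l\<in>UNIV. a l * g_comp Z p l m)" for m
  proof -
    have "h A (Bar m) = gc (vcnj (Z m p)) (S A)" using h_commute[of A "Bar m"] h_eq[of "Bar m" A] by simp
    also have "\<dots> = gc (vcnj (Z m p)) X"
      unfolding S using H(6)[OF Z_hol[OF p]] H(10)[OF Z_hol[OF p] Y] by (simp add: gc_simps)
    also have "\<dots> = (\<Sum>l\<in>UNIV. a l * g_comp Z p l m)"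
      unfolding a by (simp add: gc_sum_right gc_cscale_right g_comp_def gc_commute)
    finally show ?thesis .
  qed
  have hHol: "h A (Hol m) = (\<Sum>l\<in>UNIV. cnj (b l) * g_comp Z p m l)" for m
  proof -
    have "h A (Hol m) = gc (Z m p) (S A)" using h_commute[of A "Hol m"] h_eq[of "Hol m" A] by simp
    also have "\<dots> = gc (Z m p) (vcnj Y)"
      unfolding S using H(3)[OF Z_hol[OF p]] H(9)[OF Z_hol[OF p] X] by (simp add: gc_simps)
    also have "\<dots> = (\<Sum>l\<in>UNIV. cnj (b l) * g_comp Z p m l)"
      unfolding b by (simp add: gc_sum_right gc_cscale_right g_comp_def vcnj_sum vcnj_cscale)
    finally show ?thesis .
  qed
  have "hup A l = a l" for l
  proof -
    have "hup A l = (\<Sum>m\<in>UNIV. \<Sum>k\<in>UNIV. g_inv Z p l m * (a k * g_comp Z p k m))"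
      by (simp add: h_up_def hBar sum_distrib_left)
    also have "\<dots> = (\<Sum>k\<in>UNIV. a k * (\<Sum>m\<in>UNIV. g_inv Z p l m * g_comp Z p k m))"
      by (subst sum.swap) (simp add: sum_distrib_left mult_ac)
    finally show ?thesis by (simp add: g_inv_left if_distrib cong: if_cong)
  qed
  then have 1: "S_hol A = X" by (simp add: S_hol_def a)
  have "hupbar A l = cnj (b l)" for l
  proof -
    have "hupbar A l = (\<Sum>m\<in>UNIV. \<Sum>k\<in>UNIV. g_inv Z p m l * (cnj (b k) * g_comp Z p m k))"
      by (simp add: h_up_bar_def hHol sum_distrib_left)
    also have "\<dots> = (\<Sum>k\<in>UNIV. cnj (b k) * (\<Sum>m\<in>UNIV. g_inv Z p m l * g_comp Z p m k))"
      by (subst sum.swap) (simp add: sum_distrib_left mult_ac)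
    finally show ?thesis by (simp add: g_inv_right if_distrib cong: if_cong)
  qed
  then have 2: "S_antihol A = vcnj Y" by (simp add: S_antihol_def b vcnj_sum vcnj_cscale)
  have "h Zero A = gc (S A) (T p)" by (simp add: h_eq gc_commute)
  then have "h Zero A = f"
    unfolding S using H(3)[OF X] H(6)[OF Y] gc_T_T[OF p_in_M] by (simp add: gc_simps)
  with S 1 2 show ?thesis by simp
qed

lemma Jc_S: "Jc (S A) = cscale \<i> (S_hol A) - cscale \<i> (S_antihol A) - cscale (h Zero A) (n p)"
proof -
  have "Jc (S_hol A) = cscale \<i> (S_hol A)" "Jc (S_antihol A) = - cscale \<i> (S_antihol A)"
    using hol_tangentD(2,5)[OF p_in_M Z_hol[OF p]]
    by (simp_all add: S_hol_def S_antihol_def Jc_sum Jc_cscale cscale_sum_right cscale_minus_right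
        sum_negf[symmetric] mult.commute)
  then show ?thesis
    unfolding S_expand by (simp add: Jc_add Jc_cscale Jc_T cscale_minus_right)
qed

lemma S_parts_tangent: "S_hol A \<in> ctangent_space M p" "S_antihol A \<in> ctangent_space M p"
  unfolding ctangent_space_eq[OF p_in_M] S_hol_def S_antihol_def
  using hol_tangentD(1,4)[OF p_in_M Z_hol[OF p]] by (simp_all add: gc_sum_left gc_cscale_left)

lemmas shape_linear = D_vec_add_direction[OF n_differentiable[OF p_in_M]]
  D_vec_cscale_direction[OF n_differentiable[OF p_in_M]]
  D_vec_sum_direction[OF n_differentiable[OF p_in_M]]

lemma gc_shape_S_hol: "gc (fr A p) (shape p (S_hol B)) = (\<Sum>l\<in>UNIV. hup B l * h A (Hol l))"
  by (simp add: S_hol_def shape_linear gc_sum_right gc_cscale_right h_eq)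

lemma gc_shape_S_antihol: "gc (fr A p) (shape p (S_antihol B)) = (\<Sum>l\<in>UNIV. hupbar B l * h A (Bar l))"
  by (simp add: S_antihol_def shape_linear gc_sum_right gc_cscale_right h_eq)

lemma gc_shape_T: "gc (fr A p) (shape p (T p)) = h A Zero"
  by (simp add: h_eq)

section \<open>Torsion and the four equations\<close>

lemma gc_shape_torsion:
  "gc (fr A p) (shape p (cscale \<i> (S_hol B) - cscale \<i> (S_antihol B) + cscale c (T p))) =
    \<i> * (\<Sum>l\<in>UNIV. hup B l * h A (Hol l)) - \<i> * (\<Sum>l\<in>UNIV. hupbar B l * h A (Bar l)) + c * h A Zero"
proof -
  have "cscale \<i> (S_hol B) - cscale \<i> (S_antihol B) + cscale c (T p) =
      cscale \<i> (S_hol B) + cscale (- \<i>) (S_antihol B) + cscale c (T p)" by (simp add: cscale_minus_left)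
  then show ?thesis
    by (simp only: shape_linear gc_add_right gc_cscale_right gc_shape_S_hol gc_shape_S_antihol gc_shape_T) simp
qed

lemma torsion_tangent:
  "cscale \<i> (S_hol B) - cscale \<i> (S_antihol B) + cscale c (T p) \<in> ctangent_space M p"
  using S_parts_tangent[of B] gc_T_n by (simp add: ctangent_space_eq[OF p_in_M] gc_simps)

text \<open>Both sides contract \<open>h B (Bar m)\<close> and \<open>h A (Hol l)\<close> with
  \<open>g_inv\<close>. The identity converts the sums produced by the torsion into those of the
  equations.\<close>

lemma sum_hup_swap: "(\<Sum>l\<in>UNIV. hup B l * h A (Hol l)) = (\<Sum>l\<in>UNIV. h B (Bar l) * hupbar A l)"
proof -
  have "(\<Sum>l\<in>UNIV. hup B l * h A (Hol l)) = (\<Sum>l\<in>UNIV. \<Sum>m\<in>UNIV. g_inv Z p l m * h B (Bar m) * h A (Hol l))"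
    by (simp add: h_up_def sum_distrib_right)
  also have "\<dots> = (\<Sum>m\<in>UNIV. \<Sum>l\<in>UNIV. g_inv Z p l m * h B (Bar m) * h A (Hol l))" by (rule sum.swap)
  also have "\<dots> = (\<Sum>l\<in>UNIV. h B (Bar l) * hupbar A l)"
    by (simp add: h_up_bar_def sum_distrib_left mult_ac)
  finally show ?thesis .
qed

lemma codazzi_hol_antihol:
  "dh (Hol b) (Hol a) (Bar c) - dh (Bar c) (Hol a) (Hol b) =
    \<i> * h (Hol a) (Hol b) * h (Bar c) Zero - \<i> * h (Hol a) (Bar c) * h (Hol b) Zero
    - 2 * \<i> * h (Hol b) (Bar c) * h (Hol a) Zero"
proof -
  \<comment> \<open>The normal parts cancel by symmetry of \<open>h\<close>; the \<open>T\<close>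
    parts have opposite signs in the two defects, so they add up in the difference, whence the
    2.\<close>
  have 1: "gauss_defect (Hol b) (Bar c) - gauss_defect (Bar c) (Hol b) =
      cscale (- 2 * \<i> * h (Hol b) (Bar c)) (T p)"
  proof -
    have "cscale (- 2 * \<i> * k) (T p) = cscale (- (k * \<i>)) (T p) + cscale (- (k * \<i>)) (T p)" for k
      by (subst cscale_add_left[symmetric]) (simp add: mult_ac)
    then show ?thesis
      unfolding gauss_defect_Hol gauss_defect_Bar h_commute[of "Bar c"] by (simp add: cscale_simps)
  qed
  have 2: "cscale (- 2 * \<i> * h (Hol b) (Bar c)) (T p) \<in> ctangent_space M p"
    using gc_T_n by (simp add: ctangent_space_eq[OF p_in_M] gc_simps)
  show ?thesis
    unfolding codazzi_frame[OF 1 2] shape_linear gc_cscale_right gc_shape_T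
      gauss_defect_Hol gc_minus_left gc_cscale_left gc_diff_left gc_n_S gc_T_S h_commute[of Zero]
    by (simp add: h_commute[of "Bar c"])
qed

text \<open>The normal part of \<open>J (D_b \<nu>)\<close> is \<open>- h_{0b} \<nu>\<close>; it
  cancels against that of the defect of \<open>Z b\<close> along \<open>T\<close>, whose
  \<open>T\<close> part remains.\<close>

lemma torsion_Hol_Zero:
  "gauss_defect (Hol b) Zero - gauss_defect Zero (Hol b) =
    cscale \<i> (S_hol (Hol b)) - cscale \<i> (S_antihol (Hol b)) + cscale (- \<i> * h (Hol b) Zero) (T p)"
  unfolding gauss_defect_Zero gauss_defect_Hol Jc_S
  by (simp add: h_commute[of Zero] cscale_simps mult.commute)

lemma torsion_Bar_Zero:
  "gauss_defect (Bar b) Zero - gauss_defect Zero (Bar b) =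
    cscale \<i> (S_hol (Bar b)) - cscale \<i> (S_antihol (Bar b)) + cscale (\<i> * h (Bar b) Zero) (T p)"
  unfolding gauss_defect_Zero gauss_defect_Bar Jc_S
  by (simp add: h_commute[of Zero] cscale_simps mult.commute)

text \<open>The product of \<open>h (Hol a) Zero\<close> and \<open>h (Bar b) Zero\<close> arises
  from the defect of \<open>Z a\<close> along \<open>T\<close> and from the \<open>T\<close> part of
  the torsion, with opposite signs, and cancels.\<close>

lemma codazzi_antihol_zero:
  "dh (Bar b) (Hol a) Zero - dh Zero (Hol a) (Bar b) =
    \<i> * (\<Sum>l\<in>UNIV. h (Hol a) (Hol l) * hup (Bar b) l) - \<i> * (\<Sum>l\<in>UNIV. h (Hol a) (Bar l) * hupbar (Bar b) l)
    + \<i> * h (Hol a) (Bar b) * h Zero Zero"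
  unfolding codazzi_frame[OF torsion_Bar_Zero torsion_tangent] gc_shape_torsion
    gauss_defect_Hol gc_minus_left gc_cscale_left gc_diff_left gc_n_S gc_T_S h_commute[of Zero "Bar b"]
  by (simp add: mult_ac)

text \<open>In contrast to the barred case, the \<open>T\<close> part of the torsion has the sign of
  the defect term, so the products of \<open>h (Hol a) Zero\<close> and
  \<open>h (Hol b) Zero\<close> add up to the term with \<open>- 2 i\<close>.\<close>

lemma codazzi_hol_zero:
  "dh (Hol b) (Hol a) Zero - dh Zero (Hol a) (Hol b) =
    \<i> * (\<Sum>l\<in>UNIV. h (Hol b) (Bar l) * hupbar (Hol a) l) - \<i> * (\<Sum>l\<in>UNIV. h (Hol b) (Hol l) * hup (Hol a) l)
    + \<i> * h (Hol a) (Hol b) * h Zero Zero - 2 * \<i> * h (Hol a) Zero * h (Hol b) Zero"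
proof -
  have s: "(\<Sum>l\<in>UNIV. h (Hol b) (Hol l) * hup (Hol a) l) = (\<Sum>l\<in>UNIV. hupbar (Hol b) l * h (Hol a) (Bar l))"
    using sum_hup_swap[of "Hol a" "Hol b"] by (simp add: mult.commute)
  show ?thesis
    unfolding codazzi_frame[OF torsion_Hol_Zero torsion_tangent] gc_shape_torsion sum_hup_swap[of "Hol b"] s
      gauss_defect_Hol gc_minus_left gc_cscale_left gc_diff_left gc_n_S gc_T_S h_commute[of Zero "Hol b"]
    by (simp add: mult_ac)
qed

lemma nabla_h_comp_commute: "dh C A B = dh C B A"
proof -
  have "D_fun M p (fr C p) (\<lambda>x. sff M \<nu> x (fr A x) (fr B x)) = D_fun M p (fr C p) (\<lambda>x. sff M \<nu> x (fr B x) (fr A x))"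
    by (rule D_fun_cong_openin[OF V_open p]) (intro sff_symmetric V_subset frame_tangent)
  then show ?thesis
    using sff_symmetric[OF p_in_M nabla_tangent frame_tangent[OF p]]
    by (simp add: nabla_h_comp_def nabla_sff_def)
qed

text \<open>With \<open>T\<close> in the fixed slot both defects are \<open>J (D \<nu>)\<close>, and
  skewness of \<open>J\<close> makes their contributions equal: this is the 2. The torsion repeats
  the same two sums once, which become the last two sums when the contracted index is moved, and its
  \<open>T\<close> part gives the final product.\<close>

lemma codazzi_zero_zero:
  "dh (Hol a) Zero Zero - dh Zero (Hol a) Zero =
    2 * \<i> * (\<Sum>l\<in>UNIV. hup (Hol a) l * h (Hol l) Zero) - 2 * \<i> * (\<Sum>l\<in>UNIV. hupbar (Hol a) l * h (Bar l) Zero)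
    - \<i> * (\<Sum>l\<in>UNIV. h (Hol a) (Hol l) * hup Zero l) + \<i> * (\<Sum>l\<in>UNIV. h (Hol a) (Bar l) * hupbar Zero l)
    - \<i> * h (Hol a) Zero * h Zero Zero"
proof -
  note zero_last = h_commute[of Zero "Hol l" for l] h_commute[of Zero "Bar l" for l]
  have J: "gc (Jc (S (Hol a))) (S Zero) =
      \<i> * (\<Sum>l\<in>UNIV. hup (Hol a) l * h (Hol l) Zero) - \<i> * (\<Sum>l\<in>UNIV. hupbar (Hol a) l * h (Bar l) Zero)"
    unfolding Jc_S gc_diff_left gc_cscale_left gc_n_S S_hol_def S_antihol_def gc_sum_left
    by (simp add: h_eq)
  have J': "gc (Jc (S Zero)) (S (Hol a)) = - gc (Jc (S (Hol a))) (S Zero)"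
    using gc_Jc_left[of "S Zero" "S (Hol a)"] by (simp add: gc_commute)
  have s1: "(\<Sum>l\<in>UNIV. h (Hol a) (Bar l) * hupbar Zero l) = (\<Sum>l\<in>UNIV. hup (Hol a) l * h (Hol l) Zero)"
    using sum_hup_swap[of "Hol a" Zero] by (simp only: zero_last)
  have s2: "(\<Sum>l\<in>UNIV. h (Hol a) (Hol l) * hup Zero l) = (\<Sum>l\<in>UNIV. hupbar (Hol a) l * h (Bar l) Zero)"
    using sum_hup_swap[of Zero "Hol a"] by (simp only: zero_last mult.commute)
  show ?thesis
    unfolding nabla_h_comp_commute[of Zero "Hol a"] codazzi_frame[OF torsion_Hol_Zero torsion_tangent]
      gc_shape_torsion gauss_defect_Zero J' s1 s2 J zero_last
    by (simp add: algebra_simps)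
qed

end

theorem theorem4p1:
  fixes M V :: "(complex^'m::finite) set"
    and \<nu> :: "complex^'m \<Rightarrow> complex^'m"
    and Z :: "'n::finite \<Rightarrow> complex^'m \<Rightarrow> 'm cvec"
    and p :: "complex^'m"
    and \<alpha> \<beta> \<gamma> :: 'n
  assumes dim: "CARD('m) = CARD('n) + 1"
    and M: "oriented_hypersurface M \<nu>"
    and Z: "hol_frame M V Z"
    and p: "p \<in> V"
  shows
    "let h = h_comp M \<nu> Z p; dh = nabla_h_comp M \<nu> Z p;
         hup = h_up M \<nu> Z p; hupbar = h_up_bar M \<nu> Z p
     in
       dh (Hol \<beta>) (Hol \<alpha>) (Bar \<gamma>) - dh (Bar \<gamma>) (Hol \<alpha>) (Hol \<beta>) =
         \<i> * h (Hol \<alpha>) (Hol \<beta>) * h (Bar \<gamma>) Zero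
         - \<i> * h (Hol \<alpha>) (Bar \<gamma>) * h (Hol \<beta>) Zero
         - 2 * \<i> * h (Hol \<beta>) (Bar \<gamma>) * h (Hol \<alpha>) Zero
     \<and> dh (Bar \<beta>) (Hol \<alpha>) Zero - dh Zero (Hol \<alpha>) (Bar \<beta>) =
         \<i> * (\<Sum>l\<in>UNIV. h (Hol \<alpha>) (Hol l) * hup (Bar \<beta>) l)
         - \<i> * (\<Sum>l\<in>UNIV. h (Hol \<alpha>) (Bar l) * hupbar (Bar \<beta>) l)
         + \<i> * h (Hol \<alpha>) (Bar \<beta>) * h Zero Zero
     \<and> dh (Hol \<beta>) (Hol \<alpha>) Zero - dh Zero (Hol \<alpha>) (Hol \<beta>) =
         \<i> * (\<Sum>l\<in>UNIV. h (Hol \<beta>) (Bar l) * hupbar (Hol \<alpha>) l)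
         - \<i> * (\<Sum>l\<in>UNIV. h (Hol \<beta>) (Hol l) * hup (Hol \<alpha>) l)
         + \<i> * h (Hol \<alpha>) (Hol \<beta>) * h Zero Zero
         - 2 * \<i> * h (Hol \<alpha>) Zero * h (Hol \<beta>) Zero
     \<and> dh (Hol \<alpha>) Zero Zero - dh Zero (Hol \<alpha>) Zero =
         2 * \<i> * (\<Sum>l\<in>UNIV. hup (Hol \<alpha>) l * h (Hol l) Zero)
         - 2 * \<i> * (\<Sum>l\<in>UNIV. hupbar (Hol \<alpha>) l * h (Bar l) Zero)
         - \<i> * (\<Sum>l\<in>UNIV. h (Hol \<alpha>) (Hol l) * hup Zero l)
         + \<i> * (\<Sum>l\<in>UNIV. h (Hol \<alpha>) (Bar l) * hupbar Zero l)
         - \<i> * h (Hol \<alpha>) Zero * h Zero Zero"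
proof -
  interpret framed_hypersurface M \<nu> V Z p
    using M Z p by unfold_locales
  show ?thesis
    unfolding Let_def
    by (intro conjI codazzi_hol_antihol codazzi_antihol_zero codazzi_hol_zero codazzi_zero_zero)
qed

end
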